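(* Let $q\ge 2$ be an integer and let $A_1,A_2,\ldots,A_d$ be positive integers. For $N\ge 1$ let $n$ be chosen uniformly at random from $\{0,1,\ldots,N-1\}$. Then the random vector \[ (s_q(A_1 n), s_q(A_2 n), \ldots, s_q(A_d n)) \] satisfies a $d$-dimensional central limit theorem with asymptotic mean vector $\big(\tfrac{q-1}2,\ldots,\tfrac{q-1}2\big)\cdot\log_q N$ and asymptotic covariance matrix $\Sigma\cdot\log_q N$, where $\Sigma$ is a positive semi-definite $d\times d$ matrix; that is, as $N\to\infty$, \[ \frac{(s_q(A_1 n), \ldots, s_q(A_d n)) - \big(\tfrac{q-1}2,\ldots,\tfrac{q-1}2\big)\log_q N}{\sqrt{\log_q N}} \] converges in distribution to a centered Gaussian vector with covariance matrix $\Sigma$. If moreover $q$ is prime and none of $A_1,\ldots,A_d$ is divisible by $q$, then \[ \Sigma = \left( \frac{q^2-1}{12}\,\frac{\gcd(A_i,A_j)^2}{A_i A_j}\right)_{1\le i,j\le d}. \]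
   Context: For an integer $q\ge2$ and a non-negative integer $m$, $s_q(m)=\sum_{j\ge0}\varepsilon_j(m)$ denotes the base-$q$ sum-of-digits function, where $\varepsilon_j(m)\in\{0,\ldots,q-1\}$ is the $j$-th digit of the base-$q$ expansion $m=\sum_{j\ge0}\varepsilon_j(m)q^j$. *)

theory Defs
  imports "HOL-Probability.Probability" "HOL-Computational_Algebra.Primes"
begin

definition digit :: "nat \<Rightarrow> nat \<Rightarrow> nat \<Rightarrow> nat" where
  "digit q j m = m div q ^ j mod q"

text \<open>For \<open>q \<ge> 2\<close> only finitely many digits are nonzero, so summing over the support gives the
  full sum over \<open>j \<ge> 0\<close>.\<close>

definition digit_sum :: "nat \<Rightarrow> nat \<Rightarrow> nat" where
  "digit_sum q m = (\<Sum>j | digit q j m \<noteq> 0. digit q j m)"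

lemma digit_eq_0:
  assumes "q \<ge> 2" "m \<le> j"
  shows "digit q j m = 0"
proof -
  have "j < 2 ^ j" by (rule less_exp)
  also have "\<dots> \<le> q ^ j" using assms(1) by (rule power_mono) simp
  finally have "j < q ^ j" .
  with assms(2) have "m < q ^ j" by (rule le_less_trans)
  then have "m div q ^ j = 0" by (rule div_less)
  then show ?thesis by (simp only: digit_def mod_0)
qed

lemma digit_support_subset:
  assumes "q \<ge> 2"
  shows "{j. digit q j m \<noteq> 0} \<subseteq> {..<m}"
proof
  fix j assume "j \<in> {j. digit q j m \<noteq> 0}"
  then have "digit q j m \<noteq> 0" by (rule CollectD)
  then have "\<not> m \<le> j" by (rule contrapos_nn) (rule digit_eq_0[OF assms])
  then show "j \<in> {..<m}" by simp
qed

lemma finite_digit_support: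
  assumes "q \<ge> 2"
  shows "finite {j. digit q j m \<noteq> 0}"
  by (rule finite_subset[OF digit_support_subset[OF assms]]) simp

lemma digit_expansion:
  assumes "q \<ge> 2"
  shows "(\<Sum>j | digit q j m \<noteq> 0. digit q j m * q ^ j) = m"
proof -
  have *: "(\<Sum>j<k. digit q j m * q ^ j) + q ^ k * (m div q ^ k) = m" for k
  proof (induction k)
    case (Suc k)
    have "m div q ^ Suc k = m div q ^ k div q"
      by (simp only: power_Suc2 div_mult2_eq)
    then have "m div q ^ k = q * (m div q ^ Suc k) + digit q k m"
      unfolding digit_def by (metis mult_div_mod_eq)
    then have "q ^ k * (m div q ^ k) = q ^ k * (q * (m div q ^ Suc k) + digit q k m)"
      by (rule arg_cong)
    also have "\<dots> = digit q k m * q ^ k + q ^ Suc k * (m div q ^ Suc k)"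
      by (simp only: distrib_left power_Suc2 mult.assoc) (simp only: ac_simps)
    finally show ?case
      using Suc by (simp only: sum.lessThan_Suc)
  qed simp
  have "m < 2 ^ m" by (rule less_exp)
  also have "\<dots> \<le> q ^ m" using assms by (rule power_mono) simp
  finally have "m div q ^ m = 0" by (rule div_less)
  with *[of m] have "(\<Sum>j<m. digit q j m * q ^ j) = m"
    by (simp only: mult_0_right add_0_right)
  moreover have "(\<Sum>j | digit q j m \<noteq> 0. digit q j m * q ^ j) = (\<Sum>j<m. digit q j m * q ^ j)"
    by (rule sum.mono_neutral_left[OF _ digit_support_subset[OF assms]]) auto
  ultimately show ?thesis by (rule trans[rotated])
qed

definition pos_semidefinite :: "real ^ 'd ^ 'd \<Rightarrow> bool" where
  "pos_semidefinite S \<longleftrightarrow> transpose S = S \<and> (\<forall>x. 0 \<le> x \<bullet> (S *v x))"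

text \<open>The univariate normal law with mean \<open>m\<close> and variance \<open>v \<ge> 0\<close>; variance \<open>0\<close> means the point
  mass at \<open>m\<close>.\<close>

definition normal_law :: "real \<Rightarrow> real \<Rightarrow> real measure" where
  "normal_law m v =
     (if v = 0 then return borel m else density lborel (normal_density m (sqrt v)))"

text \<open>Gaussian vectors may be degenerate: a law on \<open>\<real>\<^sup>d\<close> is Gaussian if all its one-dimensional
  linear images are normal in the sense of \<open>normal_law\<close>.\<close>

definition gaussian_vector_law :: "(real ^ 'd) measure \<Rightarrow> bool" where
  "gaussian_vector_law \<mu> \<longleftrightarrow>
     prob_space \<mu> \<and> sets \<mu> = sets borel \<and>
     (\<forall>t. \<exists>m v. v \<ge> 0 \<and> distr \<mu> borel (\<lambda>x. t \<bullet> x) = normal_law m v)"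

definition centered_gaussian_law :: "real ^ 'd ^ 'd \<Rightarrow> (real ^ 'd) measure \<Rightarrow> bool" where
  "centered_gaussian_law S \<mu> \<longleftrightarrow>
     gaussian_vector_law \<mu> \<and>
     (\<forall>i. (\<integral>x. x $ i \<partial>\<mu>) = 0) \<and>
     (\<forall>i j. (\<integral>x. x $ i * x $ j \<partial>\<mu>) = S $ i $ j)"

text \<open>The library's \<open>weak_conv_m\<close> covers laws on \<open>\<real>\<close> only.\<close>

definition converges_in_law :: "(nat \<Rightarrow> 'a :: topological_space measure) \<Rightarrow> 'a measure \<Rightarrow> bool" where
  "converges_in_law M \<mu> \<longleftrightarrow>
     (\<forall>f :: 'a \<Rightarrow> real. continuous_on UNIV f \<and> bounded (range f) \<longrightarrow>
        (\<lambda>n. \<integral>x. f x \<partial>M n) \<longlonglongrightarrow> (\<integral>x. f x \<partial>\<mu>))"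

end

theory Submission
  imports Defs "HOL-Number_Theory.Cong"
begin

text \<open>
  Legendre's formula gives \<open>s_q(m) = (q - 1) \<Sum>\<^sub>l frac (m / q ^ l)\<close>, so a linear combination of
  the \<open>s_q(A\<^sub>i n)\<close> is, up to a bounded error, a sum \<open>F\<close> of sawtooth functions of \<open>A\<^sub>i n / q ^ l\<close>.
  Perturbing \<open>n\<close> by \<open>u \<in> [0, 1]\<close> changes \<open>F\<close> only by a bounded amount in \<open>L\<^sup>2\<close>, uniformly in the
  number of digits. Hence \<open>F\<close> is quasi-additive: cutting the digits of \<open>n\<close> in two changes it only
  by a bounded amount in \<open>L\<^sup>2\<close>. By cutting twice, the covariance of \<open>F\<close> with its value on one block
  of \<open>p\<close> digits is the variance \<open>v\<^sub>p\<close> of the latter up to \<open>O(\<surd>v\<^sub>p)\<close>. Therefore the \<open>L\<^sup>2\<close> distance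
  from \<open>F\<close> to the sum of its values on \<open>k\<close> independent blocks of length \<open>p\<close> has square \<open>o(k p)\<close> as
  first \<open>k\<close> and then \<open>p\<close> grows, and the characteristic function of that sum is a \<open>k\<close>-th power.

  The covariances are computed after refining \<open>n\<close> to \<open>n / D\<close> with a common multiple \<open>D\<close> of the
  \<open>A\<^sub>i\<close>, where the average of a product of two sawtooth functions is elementary.
\<close>

section \<open>Limits\<close>

lemma tendsto_by_approximation:
  fixes g :: "'b \<Rightarrow> 'a::metric_space" and \<beta> :: "nat \<Rightarrow> real"
  assumes approx: "\<And>p. p > 0 \<Longrightarrow> \<forall>\<^sub>F x in F. dist (g x) L \<le> y p x"
    and bound_tendsto: "\<And>p. p > 0 \<Longrightarrow> (y p \<longlongrightarrow> \<beta> p) F" and bound_limit_tendsto: "\<beta> \<longlonglongrightarrow> 0"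
  shows "(g \<longlongrightarrow> L) F"
proof (rule tendstoI)
  fix e :: real assume "e > 0"
  with bound_limit_tendsto have "\<forall>\<^sub>F p in sequentially. \<beta> p < e \<and> p > 0"
    by (intro eventually_conj eventually_gt_at_top order_tendstoD(2))
  then obtain p where p: "\<beta> p < e" "p > 0"
    by (auto simp: eventually_sequentially)
  show "\<forall>\<^sub>F x in F. dist (g x) L < e"
    using order_tendstoD(2)[OF bound_tendsto[OF p(2)] p(1)] approx[OF p(2)] by eventually_elim simp
qed

lemma real_div_over_tendsto: "(\<lambda>m. real (m div p) / real m) \<longlonglongrightarrow> 1 / real p"
proof (rule tendsto_sandwich)
  have bounds: "1 / real p - 1 / real m \<le> real (m div p) / real m"
    "real (m div p) / real m \<le> 1 / real p" if "m > 0" for m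
  proof -
    have "real (m div p) = of_int \<lfloor>real m / real p\<rfloor>" by (simp add: floor_divide_of_nat_eq)
    then have "real m / real p - 1 \<le> real (m div p)" "real (m div p) \<le> real m / real p"
      by linarith+
    from this[THEN divide_right_mono, of "real m"]
    show "1 / real p - 1 / real m \<le> real (m div p) / real m"
      "real (m div p) / real m \<le> 1 / real p"
      using that by (simp_all add: diff_divide_distrib del: divide_le_cancel)
  qed
  show "\<forall>\<^sub>F m in sequentially. 1 / real p - 1 / real m \<le> real (m div p) / real m"
    "\<forall>\<^sub>F m in sequentially. real (m div p) / real m \<le> 1 / real p"
    using bounds by (auto intro: eventually_sequentiallyI[of 1])
  show "(\<lambda>m. 1 / real p - 1 / real m) \<longlonglongrightarrow> 1 / real p"
    using tendsto_diff[OF tendsto_const lim_1_over_n] by simp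
qed simp

lemma tendsto_0_if_power2_mult_tendsto:
  fixes s :: "'b \<Rightarrow> real"
  assumes M_at_top: "filterlim M at_top F" and scale: "((\<lambda>x. (s x)\<^sup>2 * real (M x)) \<longlongrightarrow> c) F"
  shows "(s \<longlongrightarrow> 0) F"
proof -
  have "((\<lambda>x. (s x)\<^sup>2 * real (M x) * (1 / real (M x))) \<longlongrightarrow> c * 0) F"
    by (intro tendsto_mult scale filterlim_compose[OF lim_1_over_n M_at_top])
  moreover have "\<forall>\<^sub>F x in F. M x > 0"
    using M_at_top[unfolded filterlim_at_top, rule_format, of 1] by (simp add: Suc_le_eq)
  then have "\<forall>\<^sub>F x in F. (s x)\<^sup>2 * real (M x) * (1 / real (M x)) = (s x)\<^sup>2"
    by eventually_elim simp
  ultimately have "((\<lambda>x. (s x)\<^sup>2) \<longlongrightarrow> c * 0) F"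
    by (rule Lim_transform_eventually)
  then show ?thesis by simp
qed

lemma Cesaro_tendsto:
  fixes X :: "nat \<Rightarrow> real"
  assumes tendsto: "X \<longlonglongrightarrow> L"
  shows "(\<lambda>n. (\<Sum>k<n. X k) / real n) \<longlonglongrightarrow> L"
proof (rule LIMSEQ_I)
  fix r :: real assume r_pos: "r > 0"
  obtain N where close: "\<And>n. n \<ge> N \<Longrightarrow> norm (X n - L) < r / 2"
    using LIMSEQ_D[OF tendsto, of "r/2"] r_pos by auto
  define c where "c = (\<Sum>k<N. \<bar>X k - L\<bar>)"
  obtain M where M_gt: "2 * c / r < real M" using reals_Archimedean2 by blast
  show "\<exists>no. \<forall>n\<ge>no. norm ((\<Sum>k<n. X k) / real n - L) < r"
  proof (intro exI allI impI)
    fix n assume n_ge: "n \<ge> max 1 (max N M)"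
    have "(\<Sum>k<n. X k) / real n - L = (\<Sum>k<n. X k - L) / real n"
      using n_ge by (simp add: sum_subtractf field_simps)
    also have "\<bar>\<dots>\<bar> \<le> (\<Sum>k<n. \<bar>X k - L\<bar>) / real n"
      using n_ge by (simp add: divide_right_mono)
    also have "(\<Sum>k<n. \<bar>X k - L\<bar>) = c + (\<Sum>k=N..<n. \<bar>X k - L\<bar>)"
      using n_ge sum.atLeastLessThan_concat[of 0 N n "\<lambda>k. \<bar>X k - L\<bar>"]
      by (simp add: c_def atLeast0LessThan)
    also have "(\<Sum>k=N..<n. \<bar>X k - L\<bar>) \<le> (\<Sum>k=N..<n. r / 2)"
      using close by (intro sum_mono) (auto intro: less_imp_le)
    also have "(\<Sum>k=N..<n. r / 2) \<le> real n * (r / 2)"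
      using r_pos by (simp add: mult_right_mono)
    finally have "\<bar>(\<Sum>k<n. X k) / real n - L\<bar> \<le> (c + real n * (r / 2)) / real n"
      by (simp add: divide_right_mono)
    also have "\<dots> < r"
    proof -
      have "2 * c < r * real M" using M_gt r_pos by (simp add: field_simps)
      also have "\<dots> \<le> r * real n" using n_ge r_pos by simp
      finally show ?thesis using n_ge by (simp add: field_simps)
    qed
    finally show "norm ((\<Sum>k<n. X k) / real n - L) < r" by simp
  qed
qed

definition toeplitz :: "(nat \<Rightarrow> 'a) \<Rightarrow> (nat \<Rightarrow> 'a) \<Rightarrow> nat \<Rightarrow> nat \<Rightarrow> 'a" where
  "toeplitz x y l m = (if l \<le> m then x (m - l) else y (l - m))"

lemma toeplitz_sum_over_tendsto:
  fixes x y :: "nat \<Rightarrow> real"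
  assumes x_sums: "x sums a" and y_sums: "(\<lambda>d. y (Suc d)) sums b"
  shows "(\<lambda>n. (\<Sum>l<n. \<Sum>m<n. toeplitz x y l m) / real n) \<longlonglongrightarrow> a + b"
proof -
  let ?z = "toeplitz x y"
  define Z where "Z n = (\<Sum>d<Suc n. x d) + (\<Sum>d<n. y (Suc d))" for n
  have "(\<Sum>l<n. \<Sum>m<n. ?z l m) = (\<Sum>k<n. Z k)" for n
  proof (induction n)
    case (Suc n)
    have "(\<Sum>l<Suc n. ?z l n) = (\<Sum>l<Suc n. x (Suc n - Suc l))"
      by (intro sum.cong) (auto simp: toeplitz_def)
    also have "\<dots> = (\<Sum>d<Suc n. x d)" by (rule sum.nat_diff_reindex)
    finally have column: "(\<Sum>l<Suc n. ?z l n) = (\<Sum>d<Suc n. x d)" .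
    have "(\<Sum>m<n. ?z n m) = (\<Sum>m<n. y (Suc (n - Suc m)))"
      by (intro sum.cong) (auto simp: toeplitz_def Suc_diff_Suc)
    also have "\<dots> = (\<Sum>d<n. y (Suc d))" by (rule sum.nat_diff_reindex)
    finally have row: "(\<Sum>m<n. ?z n m) = (\<Sum>d<n. y (Suc d))" .
    have "(\<Sum>l<Suc n. \<Sum>m<Suc n. ?z l m)
        = (\<Sum>l<n. \<Sum>m<n. ?z l m) + ((\<Sum>l<Suc n. ?z l n) + (\<Sum>m<n. ?z n m))"
      by (simp add: sum.distrib)
    then show ?case unfolding column row Suc by (simp add: Z_def)
  qed simp
  moreover have "Z \<longlonglongrightarrow> a + b"
    using x_sums y_sums unfolding Z_def sums_def
    by (intro tendsto_add) (auto dest: LIMSEQ_Suc)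
  ultimately show ?thesis
    using Cesaro_tendsto[of Z "a + b"] by simp
qed

lemma power2_over_tendsto_if_bounded_diff:
  fixes x y :: "nat \<Rightarrow> real"
  assumes diff: "\<And>n. \<bar>x n - y n\<bar> \<le> C" and nonneg: "\<And>n. 0 \<le> y n"
    and y_rate: "(\<lambda>n. (y n)\<^sup>2 / real n) \<longlonglongrightarrow> V"
  shows "(\<lambda>n. (x n)\<^sup>2 / real n) \<longlonglongrightarrow> V"
proof -
  have V_nonneg: "0 \<le> V" using y_rate by (rule LIMSEQ_le_const) auto
  have "(\<lambda>n. sqrt ((y n)\<^sup>2 / real n)) \<longlonglongrightarrow> sqrt V" using y_rate by (rule tendsto_real_sqrt)
  then have "(\<lambda>n. y n / sqrt (real n)) \<longlonglongrightarrow> sqrt V" using nonneg by (simp add: real_sqrt_divide)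
  moreover have "(\<lambda>n. (x n - y n) / sqrt (real n)) \<longlonglongrightarrow> 0"
  proof (rule Lim_null_comparison)
    show "\<forall>\<^sub>F n in sequentially. norm ((x n - y n) / sqrt (real n)) \<le> C / sqrt (real n)"
      using diff by (simp add: divide_right_mono)
    show "(\<lambda>n. C / sqrt (real n)) \<longlonglongrightarrow> 0"
      by (intro tendsto_divide_0[OF tendsto_const] filterlim_at_top_imp_at_infinity
        filterlim_compose[OF sqrt_at_top] filterlim_real_sequentially)
  qed
  ultimately have "(\<lambda>n. y n / sqrt (real n) + (x n - y n) / sqrt (real n)) \<longlonglongrightarrow> sqrt V + 0"
    by (rule tendsto_add)
  then have "(\<lambda>n. (x n / sqrt (real n))\<^sup>2) \<longlonglongrightarrow> (sqrt V)\<^sup>2"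
    by (intro tendsto_power) (simp add: diff_divide_distrib)
  then show ?thesis using V_nonneg by (simp add: power_divide)
qed

section \<open>Averages over initial segments\<close>

definition avg :: "nat \<Rightarrow> (nat \<Rightarrow> 'a::real_vector) \<Rightarrow> 'a" where
  "avg m f = (\<Sum>n<m. f n) /\<^sub>R real m"

lemma avg_add: "avg m (\<lambda>n. f n + g n) = avg m f + avg m g"
  by (simp add: avg_def sum.distrib scaleR_add_right)

lemma avg_diff: "avg m (\<lambda>n. f n - g n) = avg m f - avg m g"
  by (simp add: avg_def sum_subtractf scaleR_diff_right)

lemma avg_mult_left: "avg m (\<lambda>n. c * f n) = c * avg m f"
  for c :: "'a::real_algebra"
  by (simp add: avg_def sum_distrib_left)

lemma avg_mult_right: "avg m (\<lambda>n. f n * c) = avg m f * c"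
  for c :: "'a::real_algebra"
  by (simp add: avg_def sum_distrib_right)

lemma avg_const: "m > 0 \<Longrightarrow> avg m (\<lambda>n. c) = c"
  by (simp add: avg_def sum_constant_scaleR)

lemma avg_sum: "avg m (\<lambda>n. \<Sum>i\<in>I. f i n) = (\<Sum>i\<in>I. avg m (f i))"
  unfolding avg_def by (subst sum.swap) (simp add: scaleR_sum_right)

lemma avg_of_real: "avg m (\<lambda>n. of_real (f n) :: 'a::real_algebra_1) = of_real (avg m f)"
  by (simp add: avg_def scaleR_conv_of_real)

lemma avg_cong: "(\<And>n. n < m \<Longrightarrow> f n = g n) \<Longrightarrow> avg m f = avg m g"
  unfolding avg_def by (metis (mono_tags, lifting) lessThan_iff sum.cong)

lemma avg_mono: "(\<And>n. n < m \<Longrightarrow> f n \<le> g n) \<Longrightarrow> avg m f \<le> avg m g"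
  for f :: "nat \<Rightarrow> real"
  unfolding avg_def by (auto intro!: mult_left_mono sum_mono)

lemma avg_nonneg: "(\<And>n. n < m \<Longrightarrow> 0 \<le> f n) \<Longrightarrow> 0 \<le> avg m f"
  for f :: "nat \<Rightarrow> real"
  unfolding avg_def by (auto intro!: sum_nonneg mult_nonneg_nonneg)

lemma norm_avg_le: "norm (avg m f) \<le> avg m (\<lambda>n. norm (f n))"
  for f :: "nat \<Rightarrow> 'a::real_normed_vector"
  unfolding avg_def by (auto intro!: mult_left_mono norm_sum)

lemma norm_avg_le_const:
  fixes f :: "nat \<Rightarrow> 'a::real_normed_vector"
  assumes "m > 0" and "\<And>n. n < m \<Longrightarrow> norm (f n) \<le> c"
  shows "norm (avg m f) \<le> c"
proof -
  have "norm (avg m f) \<le> avg m (\<lambda>_. c)"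
    by (rule order_trans[OF norm_avg_le avg_mono]) (rule assms(2))
  with assms(1) show ?thesis by (simp add: avg_const)
qed

lemma avg_lessThan_mult: "avg (a * b) f = avg a (\<lambda>x. avg b (\<lambda>y. f (x + a * y)))"
proof -
  have "(\<Sum>n<a * b. f n) = (\<Sum>y<b. \<Sum>n=y*a..<y*a+a. f n)"
    by (simp only: sum.nat_group mult.commute)
  also have "\<dots> = (\<Sum>y<b. \<Sum>x<a. f (x + a * y))"
  proof (rule sum.cong[OF refl])
    show "(\<Sum>n=y*a..<y*a+a. f n) = (\<Sum>x<a. f (x + a * y))" for y
      using sum.shift_bounds_nat_ivl[of f 0 "y*a" a]
      by (simp add: atLeast0LessThan add.commute mult.commute)
  qed
  also have "\<dots> = (\<Sum>x<a. \<Sum>y<b. f (x + a * y))"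
    by (rule sum.swap)
  finally show ?thesis
    by (simp add: avg_def scaleR_sum_right[symmetric] mult.commute)
qed

lemma avg_mult_mod_div:
  fixes f g :: "nat \<Rightarrow> 'a::real_algebra"
  shows "avg (a * b) (\<lambda>n. f (n mod a) * g (n div a)) = avg a f * avg b g"
proof -
  have "avg (a * b) (\<lambda>n. f (n mod a) * g (n div a)) = avg a (\<lambda>x. avg b (\<lambda>y. f x * g y))"
    unfolding avg_lessThan_mult by (intro avg_cong) simp
  then show ?thesis by (simp add: avg_mult_left avg_mult_right)
qed

lemma avg_div:
  assumes "a > 0"
  shows "avg (a * b) (\<lambda>n. f (n div a)) = avg b f"
proof -
  have "avg (a * b) (\<lambda>n. f (n div a)) = avg a (\<lambda>x. avg b f)"
    unfolding avg_lessThan_mult by (intro avg_cong) simp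
  then show ?thesis using assms by (simp add: avg_const)
qed

lemma avg_mod:
  assumes "b > 0" "a dvd b"
  shows "avg b (\<lambda>n. f (n mod a)) = avg a f"
proof -
  obtain c where b_eq: "b = a * c" using assms(2) by blast
  have "avg b (\<lambda>n. f (n mod a)) = avg a (\<lambda>x. avg c (\<lambda>y. f x))"
    unfolding b_eq avg_lessThan_mult by (intro avg_cong) auto
  then show ?thesis using assms(1) by (simp add: b_eq avg_const)
qed

lemma norm_avg_mod_diff_le:
  fixes h :: "nat \<Rightarrow> 'a::real_normed_vector"
  assumes h_le_1: "\<And>n. norm (h n) \<le> 1" and m_pos: "m > 0" and N_pos: "N > 0"
  shows "norm (avg N (\<lambda>n. h (n mod m)) - avg m h) \<le> 2 * real m / real N"
proof -
  define a r where "a = N div m" and "r = N mod m"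
  have N_eq: "N = m * a + r" and r_less: "r < m" using m_pos by (simp_all add: a_def r_def)
  define e where "e = (\<Sum>n<r. h n)"
  have sum_le: "norm (\<Sum>n<k. h n) \<le> real k" for k
    using sum_norm_le[of "{..<k}" h "\<lambda>_. 1"] h_le_1 by simp
  have scaleR_avg: "(\<Sum>n<k. f n) = real k *\<^sub>R avg k f" for k and f :: "nat \<Rightarrow> 'a"
    by (cases "k = 0") (simp_all add: avg_def)
  have "(\<Sum>n<N. h (n mod m)) = (\<Sum>n<m*a. h (n mod m)) + (\<Sum>n=m*a..<m*a+r. h (n mod m))"
    unfolding N_eq using sum.atLeastLessThan_concat[of 0 "m*a" "m*a+r" "\<lambda>n. h (n mod m)"]
    by (simp add: atLeast0LessThan)
  also have "(\<Sum>n<m*a. h (n mod m)) = real (m * a) *\<^sub>R avg m h"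
    using m_pos avg_mod[of "m * a" m h] by (cases "a = 0") (simp_all add: scaleR_avg)
  also have "(\<Sum>n=m*a..<m*a+r. h (n mod m)) = e"
    using sum.shift_bounds_nat_ivl[of "\<lambda>n. h (n mod m)" 0 "m*a" r] r_less
    by (simp add: e_def atLeast0LessThan add.commute)
  finally have "real N *\<^sub>R (avg N (\<lambda>n. h (n mod m)) - avg m h) = e - real r *\<^sub>R avg m h"
    by (simp add: scaleR_avg[symmetric] scaleR_diff_right)
      (simp add: N_eq scaleR_add_left)
  then have "real N * norm (avg N (\<lambda>n. h (n mod m)) - avg m h) = norm (e - real r *\<^sub>R avg m h)"
    by (metis norm_scaleR abs_of_nat)
  also have "\<dots> \<le> norm e + real r * norm (avg m h)"
    using norm_triangle_ineq4[of e "real r *\<^sub>R avg m h"] by simp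
  also have "\<dots> \<le> real r + real r * 1"
    unfolding e_def by (intro add_mono mult_left_mono sum_le norm_avg_le_const h_le_1 m_pos) auto
  also have "\<dots> \<le> 2 * real m" using r_less by simp
  finally show ?thesis using N_pos by (simp add: field_simps)
qed

subsection \<open>Root mean squares\<close>

definition rms :: "nat \<Rightarrow> (nat \<Rightarrow> real) \<Rightarrow> real" where
  "rms m f = sqrt (avg m (\<lambda>n. (f n)\<^sup>2))"

lemma rms_eq_L2_set: "rms m f = L2_set f {..<m} / sqrt (real m)"
  by (simp add: rms_def avg_def L2_set_def real_sqrt_mult real_sqrt_inverse divide_inverse)

lemma rms_nonneg [simp]: "0 \<le> rms m f"
  by (simp add: rms_eq_L2_set)

lemma rms_power2: "(rms m f)\<^sup>2 = avg m (\<lambda>n. (f n)\<^sup>2)"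
  by (simp add: rms_def avg_nonneg)

lemma rms_cong: "(\<And>n. n < m \<Longrightarrow> f n = g n) \<Longrightarrow> rms m f = rms m g"
  unfolding rms_def by (simp cong: avg_cong)

lemma rms_mult_left: "rms m (\<lambda>n. c * f n) = \<bar>c\<bar> * rms m f"
  by (simp add: rms_def power_mult_distrib avg_mult_left real_sqrt_mult)

lemma rms_div: "a > 0 \<Longrightarrow> rms (a * b) (\<lambda>n. f (n div a)) = rms b f"
  unfolding rms_def by (simp add: avg_div[where f = "\<lambda>n. (f n)\<^sup>2"])

lemma rms_mod: "b > 0 \<Longrightarrow> a dvd b \<Longrightarrow> rms b (\<lambda>n. f (n mod a)) = rms a f"
  unfolding rms_def by (simp add: avg_mod[where f = "\<lambda>n. (f n)\<^sup>2"])

lemma rms_triangle: "rms m (\<lambda>n. f n + g n) \<le> rms m f + rms m g"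
  using L2_set_triangle_ineq[of f g "{..<m}"]
  by (simp add: rms_eq_L2_set divide_right_mono flip: add_divide_distrib)

lemma rms_sum_le: "rms m (\<lambda>n. \<Sum>i\<in>I. f i n) \<le> (\<Sum>i\<in>I. rms m (f i))"
proof (induction I rule: infinite_finite_induct)
  case (insert i I)
  then show ?case using rms_triangle[of m "f i" "\<lambda>n. \<Sum>i\<in>I. f i n"] by simp
qed (simp_all add: rms_def avg_def)

lemma rms_minus_commute: "rms m (\<lambda>n. f n - g n) = rms m (\<lambda>n. g n - f n)"
  by (simp add: rms_def power2_commute)

lemma abs_rms_diff_le: "\<bar>rms m f - rms m g\<bar> \<le> rms m (\<lambda>n. f n - g n)"
  using rms_triangle[of m g "\<lambda>n. f n - g n"] rms_triangle[of m f "\<lambda>n. g n - f n"]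
    rms_minus_commute[of m f g] by auto

lemma rms_sum_mult_le:
  assumes "\<And>i. i \<in> I \<Longrightarrow> rms m (f i) \<le> C i"
  shows "rms m (\<lambda>n. \<Sum>i\<in>I. t i * f i n) \<le> (\<Sum>i\<in>I. \<bar>t i\<bar> * C i)"
proof -
  have "rms m (\<lambda>n. \<Sum>i\<in>I. t i * f i n) \<le> (\<Sum>i\<in>I. rms m (\<lambda>n. t i * f i n))"
    by (rule rms_sum_le)
  also have "\<dots> \<le> (\<Sum>i\<in>I. \<bar>t i\<bar> * C i)"
    unfolding rms_mult_left by (intro sum_mono mult_left_mono assms) auto
  finally show ?thesis .
qed

lemma rms_mult_le:
  assumes "a > 0" and "\<And>x. x < a \<Longrightarrow> rms b (\<lambda>y. f (x + a * y)) \<le> C"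
  shows "rms (a * b) f \<le> C"
proof -
  have "0 \<le> C" by (rule order_trans[OF rms_nonneg assms(2)[OF assms(1)]])
  have "norm (avg a (\<lambda>x. avg b (\<lambda>y. (f (x + a * y))\<^sup>2))) \<le> C\<^sup>2"
    using assms(2) by (intro norm_avg_le_const[OF assms(1)]) (simp add: power_mono flip: rms_power2)
  then have "(rms (a * b) f)\<^sup>2 \<le> C\<^sup>2"
    by (simp add: rms_power2 avg_lessThan_mult)
  then show ?thesis using \<open>0 \<le> C\<close> by (rule power2_le_imp_le)
qed

lemma abs_avg_mult_le: "\<bar>avg m (\<lambda>n. f n * g n)\<bar> \<le> rms m f * rms m g"
proof -
  have "\<bar>\<Sum>n<m. f n * g n\<bar> \<le> L2_set f {..<m} * L2_set g {..<m}"
    using L2_set_mult_ineq[of f g "{..<m}"] sum_abs[of "\<lambda>n. f n * g n" "{..<m}"]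
    by (simp add: abs_mult)
  then show ?thesis
    by (simp add: avg_def rms_eq_L2_set abs_mult divide_right_mono
      divide_inverse_commute[symmetric])
qed

lemma abs_avg_le_rms: "\<bar>avg m f\<bar> \<le> rms m f"
proof (cases "m = 0")
  case False
  then show ?thesis using abs_avg_mult_le[of m f "\<lambda>_. 1"] by (simp add: rms_def avg_const)
qed (simp add: avg_def)

lemma avg_power2_diff_mean:
  fixes f :: "nat \<Rightarrow> real"
  assumes "m > 0"
  shows "avg m (\<lambda>n. (f n - avg m f)\<^sup>2) = avg m (\<lambda>n. (f n)\<^sup>2) - (avg m f)\<^sup>2"
proof -
  have "avg m (\<lambda>n. (f n - avg m f)\<^sup>2) = avg m (\<lambda>n. (f n)\<^sup>2 - 2 * avg m f * f n + (avg m f)\<^sup>2)"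
    by (simp add: power2_diff ac_simps add_diff_eq)
  also have "\<dots> = avg m (\<lambda>n. (f n)\<^sup>2) - 2 * avg m f * avg m f + (avg m f)\<^sup>2"
    using assms by (simp add: avg_add avg_diff avg_mult_left avg_const)
  finally show ?thesis by (simp add: power2_eq_square)
qed

subsection \<open>Exponential averages\<close>

lemma cmod_cis_diff_le: "cmod (cis a - cis b) \<le> \<bar>a - b\<bar>"
proof -
  have "cis a - cis b = cis b * (cis (a - b) - 1)" by (simp add: algebra_simps cis_mult)
  then have "cmod (cis a - cis b) = cmod (cis (a - b) - 1)" by (simp add: norm_mult)
  also have "\<dots> \<le> \<bar>a - b\<bar>" using iexp_approx1[of "a - b" 0] by (simp add: cis_conv_exp)
  finally show ?thesis .
qed

lemma cmod_avg_cis_diff_le: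
  "cmod (avg m (\<lambda>n. cis (f n)) - avg m (\<lambda>n. cis (g n))) \<le> rms m (\<lambda>n. f n - g n)"
proof -
  have "cmod (avg m (\<lambda>n. cis (f n)) - avg m (\<lambda>n. cis (g n))) \<le> avg m (\<lambda>n. \<bar>f n - g n\<bar>)"
    unfolding avg_diff[symmetric]
    by (rule order_trans[OF norm_avg_le avg_mono]) (rule cmod_cis_diff_le)
  also have "\<dots> \<le> rms m (\<lambda>n. f n - g n)"
    using abs_avg_le_rms[of m "\<lambda>n. \<bar>f n - g n\<bar>"] by (simp add: rms_def)
  finally show ?thesis .
qed

lemma cmod_avg_cis_diff_le_const:
  assumes "m > 0" and "\<And>n. n < m \<Longrightarrow> \<bar>f n - g n\<bar> \<le> c"
  shows "cmod (avg m (\<lambda>n. cis (f n)) - avg m (\<lambda>n. cis (g n))) \<le> c"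
  unfolding avg_diff[symmetric]
  by (rule norm_avg_le_const[OF assms(1) order_trans[OF cmod_cis_diff_le assms(2)]])

lemma cis_Taylor_2: "cmod (cis y - (1 + \<i> * of_real y - of_real (y\<^sup>2 / 2))) \<le> \<bar>y\<bar> ^ 3"
proof -
  have "{..2::nat} = {0, 1, 2}" by auto
  then have "cmod (cis y - (1 + \<i> * of_real y - of_real (y\<^sup>2 / 2))) \<le> \<bar>y\<bar> ^ 3 / 6"
    using iexp_approx1[of y 2]
    by (simp add: cis_conv_exp eval_nat_numeral power2_eq_square algebra_simps)
  also have "\<dots> \<le> \<bar>y\<bar> ^ 3" by simp
  finally show ?thesis .
qed

lemma exp_minus_Taylor_1:
  fixes z :: real
  assumes "0 \<le> z"
  shows "\<bar>(1 - z) - exp (- z)\<bar> \<le> z\<^sup>2"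
proof -
  have "exp (- z) \<le> 1 / (1 + z)"
    using exp_ge_add_one_self[of z] assms by (simp add: exp_minus field_simps)
  also have "\<dots> \<le> 1 - z + z\<^sup>2"
    using assms by (simp add: field_simps power2_eq_square)
  finally show ?thesis using exp_ge_add_one_self[of "- z"] by simp
qed

lemma avg_cis_Taylor:
  fixes Y :: "nat \<Rightarrow> real"
  assumes m_pos: "m > 0" and mean: "avg m Y = 0" and s_le_1: "\<bar>s\<bar> \<le> 1"
  defines "v \<equiv> avg m (\<lambda>n. (Y n)\<^sup>2)"
  shows "cmod (avg m (\<lambda>n. cis (s * Y n)) - exp (- (v * s\<^sup>2 / 2)))
    \<le> (avg m (\<lambda>n. \<bar>Y n\<bar> ^ 3) + v\<^sup>2) * \<bar>s\<bar> ^ 3"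
proof -
  define z where "z = v * s\<^sup>2 / 2"
  define p where "p n = 1 + \<i> * of_real (s * Y n) - of_real ((s * Y n)\<^sup>2 / 2)" for n
  have "p = (\<lambda>n. 1 + \<i> * of_real (s * Y n) - of_real (s\<^sup>2 / 2 * (Y n)\<^sup>2))"
    by (simp add: p_def[abs_def] power_mult_distrib)
  then have "avg m p = 1 + \<i> * of_real (s * avg m Y) - of_real (s\<^sup>2 / 2 * v)"
    unfolding v_def avg_mult_left[symmetric]
    by (simp only: avg_diff avg_add avg_mult_left[of _ \<i>] avg_const[OF m_pos] avg_of_real)
  then have avg_p: "avg m p = of_real (1 - z)"
    by (simp add: mean z_def)
  have "cmod (avg m (\<lambda>n. cis (s * Y n)) - avg m p) \<le> avg m (\<lambda>n. \<bar>s * Y n\<bar> ^ 3)"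
    unfolding avg_diff[symmetric] p_def
    by (rule order_trans[OF norm_avg_le avg_mono]) (rule cis_Taylor_2)
  then have cubic: "cmod (avg m (\<lambda>n. cis (s * Y n)) - avg m p) \<le> avg m (\<lambda>n. \<bar>Y n\<bar> ^ 3) * \<bar>s\<bar> ^ 3"
    by (simp add: abs_mult power_mult_distrib avg_mult_left mult.commute)
  have "z\<^sup>2 = (v\<^sup>2 * \<bar>s\<bar> ^ 3) * (\<bar>s\<bar> / 4)"
    by (simp add: z_def power2_eq_square power3_eq_cube abs_if)
  also have "\<dots> \<le> v\<^sup>2 * \<bar>s\<bar> ^ 3" using s_le_1 by (intro mult_left_le) auto
  finally have "\<bar>(1 - z) - exp (- z)\<bar> \<le> v\<^sup>2 * \<bar>s\<bar> ^ 3"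
    using exp_minus_Taylor_1[of z] by (simp add: z_def v_def avg_nonneg)
  then have "cmod (avg m p - exp (- z)) \<le> v\<^sup>2 * \<bar>s\<bar> ^ 3"
    unfolding avg_p by (metis norm_of_real of_real_diff of_real_exp)
  with cubic show ?thesis
    using norm_triangle_ineq[of "avg m (\<lambda>n. cis (s * Y n)) - avg m p" "avg m p - exp (- z)"]
    by (simp add: z_def distrib_right)
qed

lemma avg_cis_power_tendsto:
  fixes Y :: "nat \<Rightarrow> real"
  assumes m_pos: "m > 0" and mean: "avg m Y = 0"
    and s_tendsto: "(s \<longlongrightarrow> 0) F" and rate: "((\<lambda>x. real (k x) * (s x)\<^sup>2) \<longlongrightarrow> c) F"
  shows "((\<lambda>x. avg m (\<lambda>n. cis (s x * Y n)) ^ k x)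
    \<longlongrightarrow> of_real (exp (- (avg m (\<lambda>n. (Y n)\<^sup>2) * c / 2)))) F"
proof -
  define v where "v = avg m (\<lambda>n. (Y n)\<^sup>2)"
  have v_nonneg: "0 \<le> v" by (simp add: v_def avg_nonneg)
  define E where "E x = complex_of_real (exp (- (v * (s x)\<^sup>2 / 2)))" for x
  let ?K = "avg m (\<lambda>n. \<bar>Y n\<bar> ^ 3) + v\<^sup>2"
  have "((\<lambda>x. avg m (\<lambda>n. cis (s x * Y n)) ^ k x - E x ^ k x) \<longlongrightarrow> 0) F"
  proof (rule Lim_null_comparison)
    show "((\<lambda>x. ?K * (real (k x) * (s x)\<^sup>2) * \<bar>s x\<bar>) \<longlongrightarrow> 0) F"
      using tendsto_mult[OF tendsto_mult[OF tendsto_const rate, of ?K]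
        tendsto_rabs_zero[OF s_tendsto]] by simp
    have "\<forall>\<^sub>F x in F. \<bar>s x\<bar> < 1"
      using tendsto_rabs_zero[OF s_tendsto] by (rule order_tendstoD) simp
    then show "\<forall>\<^sub>F x in F. norm (avg m (\<lambda>n. cis (s x * Y n)) ^ k x - E x ^ k x)
      \<le> ?K * (real (k x) * (s x)\<^sup>2) * \<bar>s x\<bar>"
    proof eventually_elim
      case (elim x)
      have "norm (avg m (\<lambda>n. cis (s x * Y n)) ^ k x - E x ^ k x)
        \<le> real (k x) * norm (avg m (\<lambda>n. cis (s x * Y n)) - E x)"
        using v_nonneg m_pos by (intro norm_power_diff norm_avg_le_const) (simp_all add: E_def)
      also have "\<dots> \<le> real (k x) * (?K * \<bar>s x\<bar> ^ 3)"
        using avg_cis_Taylor[OF m_pos mean, of "s x"] elim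
        by (intro mult_left_mono) (simp_all add: E_def v_def)
      finally show ?case by (simp add: power3_eq_cube power2_eq_square ac_simps)
    qed
  qed
  moreover have "((\<lambda>x. E x ^ k x) \<longlongrightarrow> of_real (exp (- (v * c / 2)))) F"
  proof -
    have "E x ^ k x = of_real (exp (- (v * (real (k x) * (s x)\<^sup>2) / 2)))" for x
      by (simp add: E_def ac_simps flip: of_real_power exp_of_nat_mult)
    then show ?thesis by (simp only:) (intro tendsto_intros rate, simp)
  qed
  ultimately show ?thesis
    unfolding v_def by (rule Lim_transform[rotated])
qed

section \<open>Sums over independent digit blocks\<close>

lemma digit_mod_power:
  assumes "j < k"
  shows "digit Q j (n mod Q ^ k) = digit Q j n"
proof (cases "Q = 0")
  case False
  have "Q ^ k = Q ^ j * Q ^ (k - j)" using assms by (simp flip: power_add)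
  then have "n mod Q ^ k div Q ^ j = n div Q ^ j mod Q ^ (k - j)"
    using False by (simp add: mod_mult2_eq)
  moreover have "Q dvd Q ^ (k - j)" using assms by (simp add: dvd_power)
  ultimately show ?thesis by (simp add: digit_def mod_mod_cancel)
qed (use assms in \<open>simp add: digit_def power_0_left\<close>)

lemma digit_last: "n < Q ^ Suc k \<Longrightarrow> digit Q k n = n div Q ^ k"
  by (simp add: digit_def less_mult_imp_div_less)

definition block_sum :: "(nat \<Rightarrow> real) \<Rightarrow> nat \<Rightarrow> nat \<Rightarrow> nat \<Rightarrow> real" where
  "block_sum Y Q k n = (\<Sum>j<k. Y (digit Q j n))"

lemma block_sum_mod_power: "block_sum Y Q k (n mod Q ^ k) = block_sum Y Q k n"
  by (simp add: block_sum_def digit_mod_power)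

lemma block_sum_Suc:
  "n < Q ^ Suc k \<Longrightarrow> block_sum Y Q (Suc k) n = block_sum Y Q k (n mod Q ^ k) + Y (n div Q ^ k)"
  unfolding block_sum_mod_power by (simp add: block_sum_def digit_last)

lemma avg_block_sum_power2:
  assumes "Q > 0" and "avg Q Y = 0"
  shows "avg (Q ^ k) (\<lambda>n. (block_sum Y Q k n)\<^sup>2) = real k * avg Q (\<lambda>n. (Y n)\<^sup>2)"
proof (induction k)
  case (Suc k)
  let ?T = "block_sum Y Q k"
  have "avg (Q ^ Suc k) (\<lambda>n. (block_sum Y Q (Suc k) n)\<^sup>2) = avg (Q ^ k * Q)
      (\<lambda>n. (?T (n mod Q ^ k))\<^sup>2 + (Y (n div Q ^ k))\<^sup>2 + 2 * (?T (n mod Q ^ k) * Y (n div Q ^ k)))"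
    unfolding power_Suc2[symmetric]
    by (intro avg_cong) (simp only: block_sum_Suc power2_sum mult.assoc)
  also have "\<dots> = real k * avg Q (\<lambda>n. (Y n)\<^sup>2) + avg Q (\<lambda>n. (Y n)\<^sup>2)
      + 2 * (avg (Q ^ k) ?T * avg Q Y)"
    using assms(1) by (simp add: avg_add avg_mult_left avg_mult_mod_div Suc
      avg_mod[where f = "\<lambda>n. (?T n)\<^sup>2"] avg_div[where f = "\<lambda>n. (Y n)\<^sup>2"])
  finally show ?case using assms(2) by (simp add: distrib_right)
qed (simp add: avg_def block_sum_def)

lemma avg_cis_block_sum:
  "avg (Q ^ k) (\<lambda>n. cis (s * block_sum Y Q k n)) = avg Q (\<lambda>n. cis (s * Y n)) ^ k"
proof (induction k)
  case (Suc k)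
  have "avg (Q ^ Suc k) (\<lambda>n. cis (s * block_sum Y Q (Suc k) n))
      = avg (Q ^ k * Q) (\<lambda>n. cis (s * block_sum Y Q k (n mod Q ^ k)) * cis (s * Y (n div Q ^ k)))"
    unfolding power_Suc2[symmetric]
    by (intro avg_cong) (simp only: block_sum_Suc cis_mult distrib_left)
  also have "\<dots> = avg Q (\<lambda>n. cis (s * Y n)) ^ Suc k"
    using avg_mult_mod_div[of "Q ^ k" Q "\<lambda>n. cis (s * block_sum Y Q k n)" "\<lambda>n. cis (s * Y n)"]
    by (simp add: Suc mult.commute)
  finally show ?case .
qed (simp add: avg_def block_sum_def)

section \<open>A central limit theorem for quasi-additive functions\<close>

locale digit_base =
  fixes q :: nat
  assumes base_ge_2: "2 \<le> q"
begin

lemma base_pos [simp]: "q > 0"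
  using base_ge_2 by simp

lemma base_neq_0 [simp]: "q \<noteq> 0"
  using base_ge_2 by simp

lemma avg_fun_block_sum:
  assumes "k * p \<le> M"
  shows "avg (q ^ M) (\<lambda>n. g (block_sum Y (q ^ p) k n))
    = avg ((q ^ p) ^ k) (\<lambda>n. g (block_sum Y (q ^ p) k n))"
proof -
  have "avg (q ^ M) (\<lambda>n. g (block_sum Y (q ^ p) k n))
      = avg (q ^ M) (\<lambda>n. g (block_sum Y (q ^ p) k (n mod (q ^ p) ^ k)))"
    by (simp only: block_sum_mod_power)
  also have "\<dots> = avg ((q ^ p) ^ k) (\<lambda>n. g (block_sum Y (q ^ p) k n))"
    using assms by (intro avg_mod[where f = "\<lambda>n. g (block_sum Y (q ^ p) k n)"])
      (simp_all add: le_imp_power_dvd mult.commute flip: power_mult)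
  finally show ?thesis .
qed

lemma log_at_top: "filterlim (\<lambda>N. log q N) at_top sequentially"
  unfolding log_def divide_inverse using base_ge_2
  by (intro filterlim_at_top_mult_tendsto_pos[OF tendsto_const]
    filterlim_compose[OF ln_at_top filterlim_real_sequentially]) simp

lemma floor_log_bounds:
  assumes "N > 0" "nat \<lfloor>log q N\<rfloor> = m"
  shows "\<lfloor>log q N\<rfloor> = int m" "q ^ m \<le> N" "N < q ^ Suc m"
proof -
  have "0 \<le> \<lfloor>log q N\<rfloor>" using assms(1) base_ge_2 by (simp add: zero_le_log_cancel_iff)
  then show "\<lfloor>log q N\<rfloor> = int m" using assms(2) by linarith
  then show "q ^ m \<le> N" "N < q ^ Suc m"
    using floor_log_nat_eq_powr_iff[of q N m] base_ge_2 assms(1) by simp_all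
qed

lemma floor_log_minus_at_top: "filterlim (\<lambda>N. nat \<lfloor>log q (real N)\<rfloor> - c) at_top sequentially"
  by (intro filterlim_compose[OF filterlim_minus_const_nat_at_top]
    filterlim_compose[OF filterlim_nat_sequentially]
    filterlim_compose[OF filterlim_floor_sequentially] log_at_top)

lemma floor_log_minus_over_log_tendsto:
  "(\<lambda>N. real (nat \<lfloor>log q (real N)\<rfloor> - c) / log q N) \<longlonglongrightarrow> 1"
proof -
  let ?M = "\<lambda>N. real (nat \<lfloor>log q (real N)\<rfloor> - c)"
  have log_ge: "\<forall>\<^sub>F N in sequentially. 1 + real c \<le> log q N"
    using log_at_top unfolding filterlim_at_top by (rule spec)
  have "(\<lambda>N. (log q N - ?M N) / log q N) \<longlonglongrightarrow> 0"
  proof (rule Lim_null_comparison)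
    show "\<forall>\<^sub>F N in sequentially. norm ((log q N - ?M N) / log q N) \<le> (1 + real c) / log q N"
      using log_ge
    proof eventually_elim
      case (elim N)
      then have "\<bar>log q N - ?M N\<bar> \<le> 1 + real c" by linarith
      with elim show ?case by (simp add: divide_right_mono)
    qed
    show "(\<lambda>N. (1 + real c) / log q N) \<longlonglongrightarrow> 0"
      by (intro tendsto_divide_0[OF tendsto_const] filterlim_at_top_imp_at_infinity log_at_top)
  qed
  from tendsto_diff[OF tendsto_const[of 1] this]
  have "(\<lambda>N. 1 - (log q N - ?M N) / log q N) \<longlonglongrightarrow> 1" by simp
  moreover have "\<forall>\<^sub>F N in sequentially. 1 - (log q N - ?M N) / log q N = ?M N / log q N"
    using log_ge by eventually_elim (simp add: field_simps)
  ultimately show ?thesis by (rule Lim_transform_eventually)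
qed

end

locale quasi_additive = digit_base q for q :: nat +
  fixes f :: "nat \<Rightarrow> nat \<Rightarrow> real" and C :: real
  assumes quasi_additive:
      "rms (q ^ (a + b)) (\<lambda>n. f (a + b) n - (f a (n mod q ^ a) + f b (n div q ^ a))) \<le> C"
begin

definition dev :: "nat \<Rightarrow> nat \<Rightarrow> real" where
  "dev b n = f b n - avg (q ^ b) (f b)"

abbreviation sd :: "nat \<Rightarrow> real" where
  "sd b \<equiv> rms (q ^ b) (dev b)"

text \<open>Subtracting \<open>dev p\<close> of one digit block from \<open>f M\<close> lowers the mean square by at least this
  much.\<close>

definition gain :: "nat \<Rightarrow> real" where
  "gain p = (sd p)\<^sup>2 - 4 * C * sd p"

lemma avg_dev: "avg (q ^ b) (dev b) = 0"
  unfolding dev_def[abs_def] avg_diff by (simp add: avg_const)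

lemma sd_power2: "(sd b)\<^sup>2 = avg (q ^ b) (\<lambda>n. (f b n)\<^sup>2) - (avg (q ^ b) (f b))\<^sup>2"
  unfolding rms_power2 dev_def by (rule avg_power2_diff_mean) simp

lemma avg_mult_dev: "avg (q ^ b) (\<lambda>n. f b n * dev b n) = (sd b)\<^sup>2"
proof -
  have "avg (q ^ b) (\<lambda>n. f b n * dev b n)
      = avg (q ^ b) (\<lambda>n. (dev b n)\<^sup>2 + avg (q ^ b) (f b) * dev b n)"
    by (simp add: dev_def power2_eq_square algebra_simps)
  then show ?thesis by (simp add: avg_add avg_mult_left avg_dev rms_power2)
qed

lemma rms_diff_three_blocks:
  "rms (q ^ (a + (p + b))) (\<lambda>n. f (a + (p + b)) n
     - (f a (n mod q ^ a) + f p (n div q ^ a mod q ^ p) + f b (n div q ^ a div q ^ p))) \<le> 2 * C"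
proof -
  let ?g = "\<lambda>n. f (p + b) n - (f p (n mod q ^ p) + f b (n div q ^ p))"
  have "rms (q ^ (a + (p + b))) (\<lambda>n. f (a + (p + b)) n
       - (f a (n mod q ^ a) + f p (n div q ^ a mod q ^ p) + f b (n div q ^ a div q ^ p)))
    = rms (q ^ (a + (p + b))) (\<lambda>n. (f (a + (p + b)) n
        - (f a (n mod q ^ a) + f (p + b) (n div q ^ a))) + ?g (n div q ^ a))"
    by (intro rms_cong) simp
  also have "\<dots> \<le> C + rms (q ^ (a + (p + b))) (\<lambda>n. ?g (n div q ^ a))"
    using quasi_additive[of a "p + b"] by (intro order_trans[OF rms_triangle]) simp
  also have "rms (q ^ (a + (p + b))) (\<lambda>n. ?g (n div q ^ a)) = rms (q ^ (p + b)) ?g"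
    unfolding power_add[of q a] by (rule rms_div) simp
  also have "\<dots> \<le> C" by (rule quasi_additive)
  finally show ?thesis by simp
qed

lemma avg_mult_dev_block_ge:
  "(sd p)\<^sup>2 - 2 * C * sd p
    \<le> avg (q ^ (a + (p + b))) (\<lambda>n. f (a + (p + b)) n * dev p (n div q ^ a mod q ^ p))"
proof -
  let ?M = "a + (p + b)"
  let ?d = "\<lambda>n. dev p (n mod q ^ p)"
  let ?x = "\<lambda>n. f a (n mod q ^ a)" and ?y = "\<lambda>n. f p (n mod q ^ p)" and ?z = "\<lambda>n. f b (n div q ^ p)"
  let ?r = "\<lambda>n. f ?M n - (?x n + ?y (n div q ^ a) + ?z (n div q ^ a))"
  have avg_upper: "avg (q ^ ?M) (\<lambda>n. g (n div q ^ a)) = avg (q ^ (p + b)) g" for g :: "nat \<Rightarrow> real"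
    unfolding power_add[of q a] by (rule avg_div) simp
  have "avg (q ^ ?M) (\<lambda>n. ?x n * ?d (n div q ^ a)) = 0"
    unfolding power_add[of q a] avg_mult_mod_div[where g = ?d]
    by (simp add: avg_mod[where f = "dev p"] le_imp_power_dvd avg_dev)
  moreover have "avg (q ^ (p + b)) (\<lambda>n. ?d n * ?z n) = 0"
    unfolding power_add avg_mult_mod_div by (simp add: avg_dev)
  moreover have "avg (q ^ (p + b)) (\<lambda>n. ?y n * ?d n) = (sd p)\<^sup>2"
    unfolding avg_mult_dev[symmetric]
    by (rule avg_mod[where f = "\<lambda>n. f p n * dev p n"]) (simp_all add: le_imp_power_dvd)
  moreover have "avg (q ^ ?M) (\<lambda>n. f ?M n * ?d (n div q ^ a))
    = avg (q ^ ?M) (\<lambda>n. ?r n * ?d (n div q ^ a)) + avg (q ^ ?M) (\<lambda>n. ?x n * ?d (n div q ^ a))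
      + avg (q ^ ?M) (\<lambda>n. ?y (n div q ^ a) * ?d (n div q ^ a))
      + avg (q ^ ?M) (\<lambda>n. ?d (n div q ^ a) * ?z (n div q ^ a))"
    unfolding avg_add[symmetric] by (intro avg_cong) (simp add: algebra_simps)
  moreover have "\<bar>avg (q ^ ?M) (\<lambda>n. ?r n * ?d (n div q ^ a))\<bar> \<le> 2 * C * sd p"
  proof -
    have "rms (q ^ ?M) (\<lambda>n. ?d (n div q ^ a)) = sd p"
      by (simp add: power_add[of q a] rms_div[where f = ?d] rms_mod[where f = "dev p"]
        le_imp_power_dvd)
    then have "\<bar>avg (q ^ ?M) (\<lambda>n. ?r n * ?d (n div q ^ a))\<bar> \<le> rms (q ^ ?M) ?r * sd p"
      using abs_avg_mult_le[of "q ^ ?M" ?r "\<lambda>n. ?d (n div q ^ a)"] by simp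
    also have "\<dots> \<le> 2 * C * sd p"
      by (intro mult_right_mono rms_diff_three_blocks rms_nonneg)
    finally show ?thesis .
  qed
  ultimately show ?thesis
    using avg_upper[of "\<lambda>n. ?y n * ?d n"] avg_upper[of "\<lambda>n. ?d n * ?z n"] by linarith
qed

lemma rms_diff_block_sum_power2_le:
  assumes "k * p \<le> M"
  shows "(rms (q ^ M) (\<lambda>n. f M n - block_sum (dev p) (q ^ p) k n))\<^sup>2
    \<le> avg (q ^ M) (\<lambda>n. (f M n)\<^sup>2) - real k * gain p"
proof -
  let ?T = "block_sum (dev p) (q ^ p) k"
  have block_sum_power2: "avg (q ^ M) (\<lambda>n. (?T n)\<^sup>2) = real k * (sd p)\<^sup>2"
    unfolding avg_fun_block_sum[OF assms, of "\<lambda>x. x\<^sup>2"]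
    by (simp add: avg_block_sum_power2 avg_dev rms_power2)
  have "(sd p)\<^sup>2 - 2 * C * sd p \<le> avg (q ^ M) (\<lambda>n. f M n * dev p (digit (q ^ p) j n))"
    if "j < k" for j
  proof -
    have "Suc j * p \<le> k * p" using that by (intro mult_le_mono1) simp
    then have "M = j * p + (p + (M - Suc j * p))" using assms by simp
    then show ?thesis
      using avg_mult_dev_block_ge[of p "j * p" "M - Suc j * p"]
      by (simp add: digit_def mult.commute flip: power_mult)
  qed
  from sum_mono[of "{..<k}", OF this[simplified lessThan_iff[symmetric]]]
  have "real k * ((sd p)\<^sup>2 - 2 * C * sd p) \<le> avg (q ^ M) (\<lambda>n. f M n * ?T n)"
    by (simp add: block_sum_def sum_distrib_left avg_sum)
  moreover have "(rms (q ^ M) (\<lambda>n. f M n - ?T n))\<^sup>2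
      = avg (q ^ M) (\<lambda>n. (f M n)\<^sup>2) + avg (q ^ M) (\<lambda>n. (?T n)\<^sup>2)
        - 2 * avg (q ^ M) (\<lambda>n. f M n * ?T n)"
    by (simp add: rms_power2 power2_diff mult.assoc avg_add avg_diff avg_mult_left)
  ultimately show ?thesis unfolding block_sum_power2 by (simp add: gain_def algebra_simps)
qed

lemma cmod_avg_cis_diff_block_sum_le:
  assumes "k * p \<le> M"
  shows "cmod (avg (q ^ M) (\<lambda>n. cis (s * f M n)) - avg (q ^ p) (\<lambda>n. cis (s * dev p n)) ^ k)
    \<le> sqrt (s\<^sup>2 * (avg (q ^ M) (\<lambda>n. (f M n)\<^sup>2) - real k * gain p))"
proof -
  let ?T = "block_sum (dev p) (q ^ p) k"
  have "avg (q ^ M) (\<lambda>n. cis (s * ?T n)) = avg (q ^ p) (\<lambda>n. cis (s * dev p n)) ^ k"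
    unfolding avg_fun_block_sum[OF assms, of "\<lambda>x. cis (s * x)"] by (rule avg_cis_block_sum)
  then have "cmod (avg (q ^ M) (\<lambda>n. cis (s * f M n)) - avg (q ^ p) (\<lambda>n. cis (s * dev p n)) ^ k)
    \<le> rms (q ^ M) (\<lambda>n. s * (f M n - ?T n))"
    using cmod_avg_cis_diff_le[of "q ^ M" "\<lambda>n. s * f M n" "\<lambda>n. s * ?T n"]
    by (simp add: right_diff_distrib)
  also have "\<dots> = sqrt (s\<^sup>2 * (rms (q ^ M) (\<lambda>n. f M n - ?T n))\<^sup>2)"
    by (simp add: rms_mult_left real_sqrt_mult)
  also have "\<dots> \<le> sqrt (s\<^sup>2 * (avg (q ^ M) (\<lambda>n. (f M n)\<^sup>2) - real k * gain p))"
    using assms by (intro real_sqrt_le_mono mult_left_mono rms_diff_block_sum_power2_le) auto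
  finally show ?thesis .
qed

lemma cmod_avg_cis_diff_prefix_le:
  fixes X :: "nat \<Rightarrow> real"
  assumes approx: "\<And>n M B. n < q ^ (M + B) \<Longrightarrow>
      \<bar>X n - \<mu> * real M - f M (n mod q ^ M)\<bar> \<le> D * (1 + real B)"
    and N_pos: "N > 0" and prefix_length: "M + c = nat \<lfloor>log q N\<rfloor>" and s_nonneg: "0 \<le> s"
  shows "cmod (avg N (\<lambda>n. cis (s * (X n - \<mu> * log q N))) - avg (q ^ M) (\<lambda>n. cis (s * f M n)))
    \<le> s * (D * (2 + real c) + \<bar>\<mu>\<bar> * (1 + real c)) + 2 / real q ^ c"
proof -
  note floor = floor_log_bounds[OF N_pos prefix_length[symmetric]]
  have log_diff: "\<bar>real M - log q N\<bar> \<le> 1 + real c" using floor(1) by linarith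
  define b where "b = D * (2 + real c) + \<bar>\<mu>\<bar> * (1 + real c)"
  have pointwise: "\<bar>X n - \<mu> * log q N - f M (n mod q ^ M)\<bar> \<le> b" if "n < N" for n
  proof -
    have "\<bar>X n - \<mu> * real M - f M (n mod q ^ M)\<bar> \<le> D * (2 + real c)"
      using approx[of n M "c + 1"] that floor(3) by simp
    moreover have "\<bar>\<mu> * (real M - log q N)\<bar> \<le> \<bar>\<mu>\<bar> * (1 + real c)"
      unfolding abs_mult using log_diff by (rule mult_left_mono) simp
    ultimately show ?thesis by (simp add: b_def right_diff_distrib)
  qed
  let ?x = "avg N (\<lambda>n. cis (s * (X n - \<mu> * log q N)))"
    and ?y = "avg N (\<lambda>n. cis (s * f M (n mod q ^ M)))" and ?z = "avg (q ^ M) (\<lambda>n. cis (s * f M n))"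
  have "cmod (?x - ?y) \<le> s * b"
    using s_nonneg pointwise by (intro cmod_avg_cis_diff_le_const[OF N_pos])
      (simp add: abs_mult mult_left_mono flip: right_diff_distrib)
  moreover have "cmod (?y - ?z) \<le> 2 / real q ^ c"
  proof -
    have "real q ^ M * real q ^ c \<le> real N"
      using floor(2) by (metis of_nat_le_iff of_nat_power power_add)
    then have "2 * real (q ^ M) / real N \<le> 2 / real q ^ c"
      using N_pos base_ge_2 by (simp add: field_simps)
    then show ?thesis
      using norm_avg_mod_diff_le[of "\<lambda>n. cis (s * f M n)" "q ^ M" N] N_pos by simp
  qed
  ultimately show ?thesis
    unfolding b_def using norm_triangle_ineq[of "?x - ?y" "?y - ?z"] by simp
qed

context
  fixes K V :: real
  assumes mean_bounded: "\<And>b. \<bar>avg (q ^ b) (f b)\<bar> \<le> K"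
    and variance_rate: "(\<lambda>b. avg (q ^ b) (\<lambda>n. (f b n)\<^sup>2) / real b) \<longlonglongrightarrow> V"
begin

lemma sd_power2_over_tendsto: "(\<lambda>p. (sd p)\<^sup>2 / real p) \<longlonglongrightarrow> V"
proof -
  have "(\<lambda>p. (avg (q ^ p) (f p))\<^sup>2 / real p) \<longlonglongrightarrow> 0"
  proof (rule Lim_null_comparison)
    have "(avg (q ^ p) (f p))\<^sup>2 \<le> K\<^sup>2" for p
      using mean_bounded[of p] by (metis abs_ge_zero power2_abs power_mono)
    then show "\<forall>\<^sub>F p in sequentially. norm ((avg (q ^ p) (f p))\<^sup>2 / real p) \<le> K\<^sup>2 / real p"
      by (simp add: divide_right_mono)
  qed (rule lim_const_over_n)
  from tendsto_diff[OF variance_rate this] show ?thesis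
    by (simp add: sd_power2 diff_divide_distrib)
qed

lemma block_error_tendsto_0: "(\<lambda>p. V - gain p / real p) \<longlonglongrightarrow> 0"
proof -
  have "(\<lambda>p. sqrt ((sd p)\<^sup>2 / real p * (1 / real p))) \<longlonglongrightarrow> sqrt (V * 0)"
    by (intro tendsto_real_sqrt tendsto_mult sd_power2_over_tendsto lim_1_over_n)
  then have "(\<lambda>p. sd p / real p) \<longlonglongrightarrow> 0"
    by (simp add: real_sqrt_divide flip: power2_eq_square)
  then have "(\<lambda>p. V - ((sd p)\<^sup>2 / real p - 4 * C * (sd p / real p))) \<longlonglongrightarrow> V - (V - 4 * C * 0)"
    by (intro tendsto_diff tendsto_mult tendsto_const sd_power2_over_tendsto)
  then show ?thesis by (simp add: gain_def diff_divide_distrib)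
qed

lemma avg_cis_dev_power_tendsto:
  assumes M_at_top: "filterlim M at_top F" and scale: "((\<lambda>x. (s x)\<^sup>2 * real (M x)) \<longlongrightarrow> c) F"
  shows "((\<lambda>x. avg (q ^ p) (\<lambda>n. cis (s x * dev p n)) ^ (M x div p))
    \<longlongrightarrow> of_real (exp (- ((sd p)\<^sup>2 * (c / real p) / 2)))) F"
  unfolding rms_power2
proof (rule avg_cis_power_tendsto[OF _ avg_dev tendsto_0_if_power2_mult_tendsto[OF M_at_top scale]])
  have "((\<lambda>x. real (M x div p) / real (M x) * ((s x)\<^sup>2 * real (M x))) \<longlongrightarrow> 1 / real p * c) F"
    by (intro tendsto_mult filterlim_compose[OF real_div_over_tendsto M_at_top] scale)
  moreover have "real (M x div p) / real (M x) * ((s x)\<^sup>2 * real (M x))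
      = real (M x div p) * (s x)\<^sup>2" for x
    by (cases "M x = 0") simp_all
  ultimately show "((\<lambda>x. real (M x div p) * (s x)\<^sup>2) \<longlongrightarrow> c / real p) F"
    by simp
qed simp

lemma scaled_block_error_tendsto:
  assumes M_at_top: "filterlim M at_top F" and scale: "((\<lambda>x. (s x)\<^sup>2 * real (M x)) \<longlongrightarrow> c) F"
  shows "((\<lambda>x. (s x)\<^sup>2 * (avg (q ^ M x) (\<lambda>n. (f (M x) n)\<^sup>2)
      - real (M x div p) * gain p))
    \<longlongrightarrow> c * (V - gain p / real p)) F" (is "(?\<epsilon> \<longlongrightarrow> _) F")
proof -
  have "((\<lambda>x. (s x)\<^sup>2 * real (M x) * (avg (q ^ M x) (\<lambda>n. (f (M x) n)\<^sup>2) / real (M x)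
      - real (M x div p) / real (M x) * gain p))
    \<longlongrightarrow> c * (V - 1 / real p * gain p)) F"
    by (intro tendsto_mult tendsto_diff tendsto_const scale
      filterlim_compose[OF real_div_over_tendsto M_at_top]
      filterlim_compose[OF variance_rate M_at_top])
  moreover have "(s x)\<^sup>2 * real (M x) * (avg (q ^ M x) (\<lambda>n. (f (M x) n)\<^sup>2) / real (M x)
      - real (M x div p) / real (M x) * gain p) = ?\<epsilon> x" if "M x > 0" for x
    using that by (simp add: field_simps)
  moreover have "\<forall>\<^sub>F x in F. M x > 0"
    using M_at_top[unfolded filterlim_at_top, rule_format, of 1] by (simp add: Suc_le_eq)
  ultimately have "(?\<epsilon> \<longlongrightarrow> c * (V - 1 / real p * gain p)) F"
    by (auto elim!: Lim_transform_eventually eventually_mono)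
  then show ?thesis by simp
qed

theorem avg_cis_power_base_tendsto:
  assumes M_at_top: "filterlim M at_top F" and scale: "((\<lambda>x. (s x)\<^sup>2 * real (M x)) \<longlongrightarrow> c) F"
  shows "((\<lambda>x. avg (q ^ M x) (\<lambda>n. cis (s x * f (M x) n))) \<longlongrightarrow> of_real (exp (- (V * c / 2)))) F"
proof (rule tendsto_by_approximation)
  define \<phi> where "\<phi> p x = avg (q ^ p) (\<lambda>n. cis (s x * dev p n)) ^ (M x div p)" for p x
  define \<epsilon> where "\<epsilon> p x = (s x)\<^sup>2 * (avg (q ^ M x) (\<lambda>n. (f (M x) n)\<^sup>2)
    - real (M x div p) * gain p)" for p x
  let ?L = "complex_of_real (exp (- (V * c / 2)))"
  let ?L' = "\<lambda>p. complex_of_real (exp (- ((sd p)\<^sup>2 * (c / real p) / 2)))"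
  show "\<forall>\<^sub>F x in F. dist (avg (q ^ M x) (\<lambda>n. cis (s x * f (M x) n))) ?L
      \<le> sqrt (\<epsilon> p x) + dist (\<phi> p x) ?L" if "p > 0" for p
  proof (intro always_eventually allI order_trans[OF dist_triangle add_mono[OF _ order_refl]])
    show "dist (avg (q ^ M x) (\<lambda>n. cis (s x * f (M x) n))) (\<phi> p x) \<le> sqrt (\<epsilon> p x)" for x
      unfolding dist_norm \<phi>_def \<epsilon>_def by (rule cmod_avg_cis_diff_block_sum_le) simp
  qed
  show "((\<lambda>x. sqrt (\<epsilon> p x) + dist (\<phi> p x) ?L)
      \<longlongrightarrow> sqrt (c * (V - gain p / real p)) + dist (?L' p) ?L) F"
    if "p > 0" for p
    unfolding \<epsilon>_def \<phi>_def
    by (intro tendsto_add tendsto_real_sqrt tendsto_dist tendsto_const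
      scaled_block_error_tendsto[OF M_at_top scale] avg_cis_dev_power_tendsto[OF M_at_top scale])
  show "(\<lambda>p. sqrt (c * (V - gain p / real p)) + dist (?L' p) ?L) \<longlonglongrightarrow> 0"
  proof -
    have "(\<lambda>p. complex_of_real (exp (- ((sd p)\<^sup>2 / real p * c / 2)))) \<longlonglongrightarrow> ?L"
      by (intro tendsto_intros sd_power2_over_tendsto) simp
    then have "(\<lambda>p. dist (?L' p) ?L) \<longlonglongrightarrow> dist ?L ?L"
      by (intro tendsto_dist tendsto_const) simp
    moreover have "(\<lambda>p. sqrt (c * (V - gain p / real p))) \<longlonglongrightarrow> sqrt (c * 0)"
      by (intro tendsto_real_sqrt tendsto_mult tendsto_const block_error_tendsto_0)
    ultimately show ?thesis using tendsto_add by fastforce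
  qed
qed

lemma avg_cis_prefix_tendsto:
  fixes c :: nat
  defines "M \<equiv> \<lambda>N. nat \<lfloor>log q (real N)\<rfloor> - c"
  shows "(\<lambda>N. avg (q ^ M N) (\<lambda>n. cis (1 / sqrt (log q N) * f (M N) n)))
    \<longlonglongrightarrow> of_real (exp (- (V / 2)))"
proof -
  have "\<forall>\<^sub>F N in sequentially. 1 \<le> log q (real N)"
    using log_at_top unfolding filterlim_at_top by (rule spec)
  then have "\<forall>\<^sub>F N in sequentially. real (M N) / log q N = (1 / sqrt (log q N))\<^sup>2 * real (M N)"
    by eventually_elim (simp add: power_divide)
  then have scale: "(\<lambda>N. (1 / sqrt (log q N))\<^sup>2 * real (M N)) \<longlonglongrightarrow> 1"
    unfolding M_def by (rule Lim_transform_eventually[OF floor_log_minus_over_log_tendsto])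
  have "filterlim M at_top sequentially"
    unfolding M_def by (rule floor_log_minus_at_top)
  from avg_cis_power_base_tendsto[OF this scale] show ?thesis by simp
qed

theorem avg_cis_normalized_tendsto:
  fixes X :: "nat \<Rightarrow> real"
  assumes approx: "\<And>n M B. n < q ^ (M + B) \<Longrightarrow>
      \<bar>X n - \<mu> * real M - f M (n mod q ^ M)\<bar> \<le> D * (1 + real B)"
  shows "(\<lambda>N. avg N (\<lambda>n. cis ((X n - \<mu> * log q N) / sqrt (log q N))))
    \<longlonglongrightarrow> of_real (exp (- (V / 2)))"
proof (rule tendsto_by_approximation)
  define s where "s N = 1 / sqrt (log q N)" for N :: nat
  define M where "M c N = nat \<lfloor>log q N\<rfloor> - c" for c N :: nat
  let ?L = "complex_of_real (exp (- (V / 2)))"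
  have log_ge: "\<forall>\<^sub>F N in sequentially. log q N \<ge> 1 + real c" for c
    using log_at_top unfolding filterlim_at_top by (rule spec)
  show "\<forall>\<^sub>F N in sequentially. dist (avg N (\<lambda>n. cis ((X n - \<mu> * log q N) / sqrt (log q N)))) ?L
    \<le> s N * (D * (2 + real c) + \<bar>\<mu>\<bar> * (1 + real c)) + 2 / real q ^ c
      + dist (avg (q ^ M c N) (\<lambda>n. cis (s N * f (M c N) n))) ?L" for c
    using log_ge[of c] eventually_gt_at_top[of 0]
  proof eventually_elim
    case (elim N)
    then have "M c N + c = nat \<lfloor>log q N\<rfloor>" "0 \<le> s N"
      by (simp_all add: M_def s_def le_nat_floor)
    from cmod_avg_cis_diff_prefix_le[OF approx elim(2) this] show ?case
      by (intro order_trans[OF dist_triangle add_mono[OF _ order_refl]]) (simp add: dist_norm s_def)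
  qed
  show "(\<lambda>N. s N * (D * (2 + real c) + \<bar>\<mu>\<bar> * (1 + real c)) + 2 / real q ^ c
      + dist (avg (q ^ M c N) (\<lambda>n. cis (s N * f (M c N) n))) ?L) \<longlonglongrightarrow> 2 / real q ^ c" for c
  proof -
    have "s \<longlonglongrightarrow> 0" unfolding s_def
      by (intro tendsto_divide_0[OF tendsto_const] filterlim_at_top_imp_at_infinity
        filterlim_compose[OF sqrt_at_top log_at_top])
    then have "(\<lambda>N. s N * (D * (2 + real c) + \<bar>\<mu>\<bar> * (1 + real c))) \<longlonglongrightarrow> 0"
      by (rule tendsto_mult_left_zero)
    moreover have "(\<lambda>N. avg (q ^ M c N) (\<lambda>n. cis (s N * f (M c N) n))) \<longlonglongrightarrow> ?L"
      unfolding s_def M_def by (rule avg_cis_prefix_tendsto)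
    ultimately have "(\<lambda>N. s N * (D * (2 + real c) + \<bar>\<mu>\<bar> * (1 + real c)) + 2 / real q ^ c
      + dist (avg (q ^ M c N) (\<lambda>n. cis (s N * f (M c N) n))) ?L) \<longlonglongrightarrow> 0 + 2 / real q ^ c + dist ?L ?L"
      by (intro tendsto_add tendsto_dist tendsto_const)
    then show ?thesis by simp
  qed
  show "(\<lambda>c. 2 / real q ^ c) \<longlonglongrightarrow> 0"
    using base_ge_2 by (intro LIMSEQ_divide_realpow_zero) simp
qed

end

end

section \<open>The sawtooth function\<close>

definition saw :: "real \<Rightarrow> real" where
  "saw x = frac x - 1/2"

lemma saw_add_of_nat [simp]: "saw (x + of_nat k) = saw x"
  using frac_add_of_int_right[of x "int k"] by (simp add: saw_def)

lemma saw_eq: "0 \<le> x \<Longrightarrow> x < 1 \<Longrightarrow> saw x = x - 1/2"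
  by (simp add: saw_def)

lemma saw_mult_mod:
  assumes "m dvd K"
  shows "saw (real a * (real (n mod K) + u) / real m) = saw (real a * (real n + u) / real m)"
proof (cases "m = 0")
  case False
  obtain c where "K = m * c" using assms by blast
  then have "real n = real (n mod K) + real m * real (c * (n div K))"
    by (metis mod_mult_div_eq mult.assoc of_nat_add of_nat_mult)
  then have "real a * (real n + u) / real m
      = real a * (real (n mod K) + u) / real m + of_nat (a * (c * (n div K)))"
    using False by (simp add: field_simps)
  then show ?thesis by (simp only: saw_add_of_nat)
qed simp

lemma saw_of_nat_mod: "P dvd K \<Longrightarrow> saw (real (n mod K) / real P) = saw (real n / real P)"
  using saw_mult_mod[of P K 1 n 0] by simp

text \<open>The absolute values of the increments sum to at most \<open>2 a\<close> because those of the floors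
  telescope.\<close>

lemma rms_saw_shift_le:
  assumes m_pos: "m > 0" and u_range: "0 \<le> u" "u \<le> 1"
  shows "rms m (\<lambda>n. saw (real a * (real n + u) / real m) - saw (real a * real n / real m))
    \<le> sqrt (2 * real a / real m)"
proof -
  define e where "e n = saw (real a * (real n + u) / real m) - saw (real a * real n / real m)" for n
  define g where "g n = real_of_int \<lfloor>real a * real n / real m\<rfloor>" for n
  have "(e n)\<^sup>2 \<le> real a / real m + (g (Suc n) - g n)" for n
  proof -
    define x y where "x = real a * (real n + u) / real m" and "y = real a * real n / real m"
    define h where "h = real_of_int \<lfloor>x\<rfloor>"
    have "real a * real n \<le> real a * (real n + u)" "real a * (real n + u) \<le> real a * real (Suc n)"
      using u_range by (auto intro!: mult_left_mono)
    then have floor_bounds: "g n \<le> h" "h \<le> g (Suc n)"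
      unfolding g_def h_def x_def of_int_le_iff by (auto intro!: floor_mono divide_right_mono)
    define \<delta> where "\<delta> = real a * u / real m"
    have "x = y + \<delta>"
      by (simp add: x_def y_def \<delta>_def distrib_left add_divide_distrib)
    moreover have e_eq: "e n = (x - h) - (y - g n)"
      by (simp add: e_def saw_def frac_def x_def y_def h_def g_def)
    moreover have "0 \<le> \<delta>" "\<delta> \<le> real a / real m"
      unfolding \<delta>_def using u_range by (auto intro!: divide_right_mono mult_left_le)
    ultimately have "\<bar>e n\<bar> \<le> real a / real m + (h - g n)"
      using floor_bounds(1) by linarith
    moreover have "\<bar>e n\<bar> \<le> 1"
      using frac_lt_1[of x] frac_lt_1[of y] frac_ge_0[of x] frac_ge_0[of y]
      unfolding e_eq h_def g_def frac_def y_def by linarith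
    then have "(e n)\<^sup>2 \<le> \<bar>e n\<bar>"
      using mult_left_le[of "\<bar>e n\<bar>" "\<bar>e n\<bar>"] by (simp add: power2_eq_square)
    ultimately show ?thesis using floor_bounds(2) by linarith
  qed
  then have "avg m (\<lambda>n. (e n)\<^sup>2) \<le> avg m (\<lambda>n. real a / real m + (g (Suc n) - g n))"
    by (rule avg_mono)
  also have "\<dots> = real a / real m + (g m - g 0) / real m"
    using m_pos by (simp add: avg_add avg_const)
      (simp add: avg_def sum_lessThan_telescope divide_inverse mult.commute)
  also have "\<dots> = 2 * real a / real m"
    using m_pos by (simp add: g_def)
  finally show ?thesis
    unfolding rms_def e_def by (rule real_sqrt_le_mono)
qed

subsection \<open>Correlations of sawtooth functions\<close>

lemma avg_of_nat:
  assumes "m > 0"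
  shows "avg m real = (real m - 1) / 2"
proof -
  have sum: "(\<Sum>k<m. real k) = real m * (real m - 1) / 2" for m
    by (induction m) (auto simp: field_simps)
  show ?thesis using assms unfolding avg_def sum by simp
qed

lemma avg_saw_progression:
  assumes "r < d" "m > 0"
  shows "avg m (\<lambda>k. saw (real (r + d * k) / real (d * m))) = saw (real r / real d) / real m"
proof -
  have "saw (real (r + d * k) / real (d * m)) = (real r / real d + real k) / real m - 1/2"
    if "k < m" for k
  proof -
    have "r + d * k < d * Suc k" using assms(1) by simp
    also have "\<dots> \<le> d * m" using that by (intro mult_le_mono2) simp
    finally show ?thesis
      using assms by (subst saw_eq) (simp_all add: field_simps flip: of_nat_mult of_nat_add)
  qed
  then have "avg m (\<lambda>k. saw (real (r + d * k) / real (d * m)))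
      = avg m (\<lambda>k. (real r / real d + real k) / real m - 1/2)"
    by (rule avg_cong)
  also have "\<dots> = (real r / real d + (real m - 1) / 2) / real m - 1/2"
    using assms(2) unfolding divide_inverse[of _ "real m"]
    by (simp add: avg_diff avg_add avg_const avg_mult_right avg_of_nat)
  also have "\<dots> = saw (real r / real d) / real m"
    using assms by (subst saw_eq) (simp_all add: field_simps)
  finally show ?thesis .
qed

lemma avg_saw_power2:
  assumes "d > 0"
  shows "avg d (\<lambda>r. (saw (real r / real d))\<^sup>2) = ((real d)\<^sup>2 + 2) / (12 * (real d)\<^sup>2)"
proof -
  have "(\<Sum>r<n. (2 * real r - c)\<^sup>2) = 2 * real n * (real n - 1) * (2 * real n - 1) / 3
      - 2 * c * real n * (real n - 1) + c\<^sup>2 * real n" for n c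
  proof (induction n)
    case (Suc n)
    then show ?case unfolding sum.lessThan_Suc Suc by (simp add: field_simps power2_eq_square)
  qed simp
  from this[of "real d" d]
  have scaled: "avg d (\<lambda>r. (2 * real r - real d)\<^sup>2) = ((real d)\<^sup>2 + 2) / 3"
    using assms by (simp add: avg_def field_simps power2_eq_square)
  have "avg d (\<lambda>r. (saw (real r / real d))\<^sup>2)
      = avg d (\<lambda>r. 1 / (2 * real d)\<^sup>2 * (2 * real r - real d)\<^sup>2)"
    by (intro avg_cong) (simp add: saw_eq field_simps power2_eq_square)
  also have "\<dots> = ((real d)\<^sup>2 + 2) / (12 * (real d)\<^sup>2)"
    unfolding avg_mult_left scaled by (simp add: power_mult_distrib)
  finally show ?thesis .
qed

lemma avg_mod_mult_coprime:
  fixes f g :: "nat \<Rightarrow> 'a::real_algebra"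
  assumes "P > 0" "Q > 0" "coprime P Q"
  shows "avg (P * Q) (\<lambda>n. f (n mod P) * g (n mod Q)) = avg P f * avg Q g"
proof -
  let ?h = "\<lambda>n. (n mod P, n mod Q)" and ?T = "{..<P} \<times> {..<Q}"
  have "inj_on ?h {..<P * Q}"
    using assms(3) by (intro inj_onI cong_less_modulus_unique_nat[OF coprime_cong_mult_nat])
      (auto simp: cong_def)
  moreover have "?h ` {..<P * Q} \<subseteq> ?T" using assms by auto
  ultimately have "bij_betw ?h {..<P * Q} ?T"
    by (simp add: bij_betw_def card_subset_eq card_image)
  then have "(\<Sum>n<P * Q. f (n mod P) * g (n mod Q)) = (\<Sum>(x, y)\<in>?T. f x * g y)"
    by (subst sum.reindex_bij_betw[symmetric, where h = ?h]) auto
  also have "\<dots> = (\<Sum>x<P. f x) * (\<Sum>y<Q. g y)"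
    by (simp add: sum_product sum.cartesian_product)
  finally show ?thesis by (simp add: avg_def mult.commute)
qed

lemma avg_saw_mult_saw_progression:
  assumes "r < d" "P > 0" "Q > 0" "coprime P Q"
  shows "avg (P * Q)
      (\<lambda>k. saw (real (r + d * k) / real (d * P)) * saw (real (r + d * k) / real (d * Q)))
    = 1 / (real P * real Q) * (saw (real r / real d))\<^sup>2"
proof -
  have "saw (real (r + d * k) / real (d * m)) = saw (real (r + d * (k mod m)) / real (d * m))"
    for k m
    using saw_of_nat_mod[of "d * m" "d * m" "r + d * k"] assms(1)
    by (simp add: mod_mult2_eq add.commute)
  then have "avg (P * Q)
      (\<lambda>k. saw (real (r + d * k) / real (d * P)) * saw (real (r + d * k) / real (d * Q)))
    = avg (P * Q) (\<lambda>k. saw (real (r + d * (k mod P)) / real (d * P))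
        * saw (real (r + d * (k mod Q)) / real (d * Q)))"
    by (metis (no_types))
  also have "\<dots> = avg P (\<lambda>k. saw (real (r + d * k) / real (d * P)))
      * avg Q (\<lambda>k. saw (real (r + d * k) / real (d * Q)))"
    using avg_mod_mult_coprime[OF assms(2-4)] by simp
  also have "\<dots> = 1 / (real P * real Q) * (saw (real r / real d))\<^sup>2"
    using assms by (simp only: avg_saw_progression) (simp add: power2_eq_square)
  finally show ?thesis .
qed

lemma avg_saw_mult_saw_residues:
  assumes "K > 0" "P dvd K" "Q dvd K"
  shows "avg K (\<lambda>n. saw (real n / real P) * saw (real n / real Q))
    = ((real (gcd P Q))\<^sup>2 + 2) / (12 * real P * real Q)"
proof -
  have PQ_pos: "P > 0" "Q > 0" using assms by (auto intro: gr0I)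
  define d where "d = gcd P Q"
  have d_pos: "d > 0" using PQ_pos by (simp add: d_def)
  obtain p' q' where P_eq: "P = d * p'" and Q_eq: "Q = d * q'" and "coprime p' q'"
    using PQ_pos by (metis d_def gcd_coprime_exists gcd_pos_nat less_numeral_extra(3) mult.commute)
  have pos: "p' > 0" "q' > 0" using PQ_pos P_eq Q_eq by auto
  define s where "s n = saw (real n / real P) * saw (real n / real Q)" for n
  have "avg K s = avg K (\<lambda>n. s (n mod (d * (p' * q'))))"
    by (simp add: s_def[abs_def] saw_of_nat_mod P_eq Q_eq del: of_nat_mult)
  also have "\<dots> = avg (d * (p' * q')) s"
  proof (rule avg_mod[OF assms(1)])
    have "d * lcm P Q = P * Q" unfolding d_def by (rule prod_gcd_lcm_nat[symmetric])
    also have "\<dots> = d * (d * (p' * q'))" by (simp add: P_eq Q_eq)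
    finally have "d * (p' * q') = lcm P Q" using d_pos by simp
    then show "d * (p' * q') dvd K" using assms by simp
  qed
  also have "\<dots> = avg d (\<lambda>r. 1 / (real p' * real q') * (saw (real r / real d))\<^sup>2)"
    unfolding avg_lessThan_mult[of d] s_def P_eq Q_eq
    by (intro avg_cong avg_saw_mult_saw_progression pos \<open>coprime p' q'\<close>)
  also have "\<dots> = ((real d)\<^sup>2 + 2) / (12 * real P * real Q)"
    unfolding avg_mult_left avg_saw_power2[OF d_pos] by (simp add: P_eq Q_eq power2_eq_square)
  finally show ?thesis by (simp add: d_def s_def[abs_def])
qed

lemma avg_saw_mult_saw:
  assumes "K > 0" "a dvd K" "b dvd K"
  shows "avg K (\<lambda>n. saw (real a * real n / real K) * saw (real b * real n / real K))
    = (real (gcd a b))\<^sup>2 / (12 * real a * real b) + real a * real b / (6 * (real K)\<^sup>2)"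
proof -
  obtain P Q where K_eq_aP: "K = a * P" and K_eq_bQ: "K = b * Q" using assms by blast
  have pos: "a > 0" "b > 0" "P > 0" "Q > 0" using assms(1) K_eq_aP K_eq_bQ by (auto intro: gr0I)
  have "a * b * gcd P Q = gcd (K * b) (K * a)"
    by (metis K_eq_aP K_eq_bQ gcd_mult_distrib_nat mult.assoc mult.commute)
  also have "\<dots> = K * gcd a b" by (metis gcd.commute gcd_mult_distrib_nat)
  finally have gcd: "real (gcd P Q) = real K * real (gcd a b) / (real a * real b)"
    using pos by (simp add: field_simps flip: of_nat_mult)
  have inverse: "real P = real K / real a" "real Q = real K / real b"
    using pos by (simp add: K_eq_aP, simp add: K_eq_bQ)
  have "avg K (\<lambda>n. saw (real a * real n / real K) * saw (real b * real n / real K))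
      = avg K (\<lambda>n. saw (real n / real P) * saw (real n / real Q))"
    using pos unfolding inverse by (simp add: ac_simps)
  also have "\<dots> = ((real (gcd P Q))\<^sup>2 + 2) / (12 * real P * real Q)"
    using assms(1) K_eq_aP K_eq_bQ by (intro avg_saw_mult_saw_residues) (metis dvd_triv_right)+
  also have "\<dots> = (real (gcd a b))\<^sup>2 / (12 * real a * real b) + real a * real b / (6 * (real K)\<^sup>2)"
    unfolding gcd inverse using pos assms(1) by (simp add: field_simps power2_eq_square)
  finally show ?thesis .
qed

lemma avg_saw:
  assumes "K > 0" "a dvd K"
  shows "avg K (\<lambda>n. saw (real a * real n / real K)) = - real a / (2 * real K)"
proof -
  obtain P where K_eq: "K = a * P" using assms by blast
  then have pos: "a > 0" "P > 0" using assms(1) by (auto intro: gr0I)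
  have "avg K (\<lambda>n. saw (real a * real n / real K)) = avg K (\<lambda>n. saw (real (n mod P) / real P))"
    using pos by (simp add: K_eq saw_of_nat_mod)
  also have "\<dots> = avg P (\<lambda>n. saw (real n / real P))"
    using pos K_eq by (intro avg_mod[where f = "\<lambda>n. saw (real n / real P)"]) simp_all
  also have "\<dots> = - real a / (2 * real K)"
    using avg_saw_progression[of 0 1 P] pos by (simp add: saw_eq K_eq)
  finally show ?thesis .
qed

subsection \<open>Sums of sawtooth functions along powers of the base\<close>

context digit_base
begin

definition saw_sum :: "nat \<Rightarrow> nat \<Rightarrow> real \<Rightarrow> real" where
  "saw_sum a b x = (\<Sum>l=1..b. saw (real a * x / real q ^ l))"

lemma saw_sum_rev: "saw_sum a b x = (\<Sum>l<b. saw (real (a * q ^ l) * x / real q ^ b))"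
proof -
  have "saw_sum a b x = (\<Sum>l<b. saw (real a * x / real q ^ Suc l))"
    by (simp add: saw_sum_def sum.atLeast1_atMost_eq)
  also have "\<dots> = (\<Sum>l<b. saw (real a * x / real q ^ Suc (b - Suc l)))"
    by (rule sum.nat_diff_reindex[symmetric])
  also have "\<dots> = (\<Sum>l<b. saw (real (a * q ^ l) * x / real q ^ b))"
  proof (rule sum.cong[OF refl])
    fix l assume "l \<in> {..<b}"
    then have "real q ^ b = real q ^ l * real q ^ Suc (b - Suc l)"
      by (simp flip: power_add power_Suc)
    then show "saw (real a * x / real q ^ Suc (b - Suc l))
        = saw (real (a * q ^ l) * x / real q ^ b)"
      by simp
  qed
  finally show ?thesis .
qed

lemma saw_sum_add: "saw_sum a (b + c) x = saw_sum a b x + saw_sum a c (x / real q ^ b)"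
proof -
  have "saw_sum a (b + c) x = saw_sum a b x + (\<Sum>l=1..c. saw (real a * x / real q ^ (l + b)))"
    using sum.ub_add_nat[of 1 b "\<lambda>l. saw (real a * x / real q ^ l)" c]
      sum.shift_bounds_cl_nat_ivl[of "\<lambda>l. saw (real a * x / real q ^ l)" 1 b c]
    by (simp add: saw_sum_def add.commute)
  then show ?thesis by (simp add: saw_sum_def power_add mult.commute)
qed

lemma saw_sum_mod: "saw_sum a b (real (n mod q ^ b)) = saw_sum a b (real n)"
  unfolding saw_sum_def using saw_mult_mod[of "q ^ _" "q ^ b" a n 0]
  by (intro sum.cong refl) (simp add: le_imp_power_dvd)

lemma rms_saw_power_shift_le:
  assumes u_range: "0 \<le> u" "u \<le> 1" and "l \<le> b"
  shows "rms (q ^ b)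
      (\<lambda>n. saw (real a * (real n + u) / real q ^ l) - saw (real a * real n / real q ^ l))
    \<le> sqrt 2 * sqrt (real a) * (1 / sqrt 2) ^ l"
proof -
  define e where
    "e n = saw (real a * (real n + u) / real (q ^ l)) - saw (real a * real n / real (q ^ l))" for n
  have "e (n mod q ^ l) = e n" for n
    unfolding e_def using saw_mult_mod[OF dvd_refl, of a n "q ^ l"]
    by (metis add_0_right)
  then have "rms (q ^ b) e = rms (q ^ b) (\<lambda>n. e (n mod q ^ l))" by simp
  also have "\<dots> = rms (q ^ l) e"
    using assms(3) by (intro rms_mod) (simp_all add: le_imp_power_dvd)
  also have "\<dots> \<le> sqrt (2 * real a / real (q ^ l))"
    unfolding e_def[abs_def] by (rule rms_saw_shift_le[OF _ u_range]) simp
  also have "\<dots> \<le> sqrt (2 * real a / 2 ^ l)"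
    using base_ge_2 by (intro real_sqrt_le_mono divide_left_mono) (auto intro!: power_mono)
  also have "\<dots> = sqrt 2 * sqrt (real a) * (1 / sqrt 2) ^ l"
    by (simp add: real_sqrt_mult real_sqrt_divide real_sqrt_power power_divide)
  finally show ?thesis by (simp add: e_def[abs_def])
qed

lemma rms_saw_sum_shift_le:
  assumes u_range: "0 \<le> u" "u \<le> 1"
  shows "rms (q ^ b) (\<lambda>n. saw_sum a b (real n + u) - saw_sum a b (real n)) \<le> 5 * sqrt (real a)"
proof -
  have "rms (q ^ b) (\<lambda>n. saw_sum a b (real n + u) - saw_sum a b (real n))
      \<le> (\<Sum>l=1..b. rms (q ^ b)
          (\<lambda>n. saw (real a * (real n + u) / real q ^ l) - saw (real a * real n / real q ^ l)))"
    unfolding saw_sum_def sum_subtractf[symmetric] by (rule rms_sum_le)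
  also have "\<dots> \<le> sqrt 2 * sqrt (real a) * (\<Sum>l=1..b. (1 / sqrt 2) ^ l)"
    unfolding sum_distrib_left by (intro sum_mono rms_saw_power_shift_le u_range) simp
  also have "\<dots> \<le> sqrt 2 * sqrt (real a) * (1 / (1 - 1 / sqrt 2))"
    by (rule mult_left_mono[OF less_imp_le[OF geometric_sum_less]]) auto
  also have "\<dots> \<le> 5 * sqrt (real a)"
  proof -
    have "sqrt 2 \<le> 3 / 2" by (rule real_le_lsqrt) (simp_all add: power2_eq_square)
    have "sqrt 2 * (1 / (1 - 1 / sqrt 2)) = 2 * (sqrt 2 + 1)"
      by (simp add: field_simps)
    also have "\<dots> \<le> 5" using \<open>sqrt 2 \<le> 3 / 2\<close> by simp
    finally have "sqrt 2 * (1 / (1 - 1 / sqrt 2)) \<le> 5" .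
    from mult_right_mono[OF this, of "sqrt (real a)"] show ?thesis by (simp add: ac_simps)
  qed
  finally show ?thesis .
qed

lemma rms_saw_sum_div_le:
  assumes "D > 0"
  shows "rms (D * q ^ b) (\<lambda>n. saw_sum a b (real n / real D) - saw_sum a b (real (n div D)))
    \<le> 5 * sqrt (real a)"
proof (rule rms_mult_le[OF assms])
  fix x assume x_less: "x < D"
  then have "rms (q ^ b) (\<lambda>y. saw_sum a b (real y + real x / real D) - saw_sum a b (real y))
      \<le> 5 * sqrt (real a)"
    by (intro rms_saw_sum_shift_le) simp_all
  with x_less show "rms (q ^ b) (\<lambda>y. saw_sum a b (real (x + D * y) / real D)
      - saw_sum a b (real ((x + D * y) div D))) \<le> 5 * sqrt (real a)"
    by (simp add: add_divide_distrib add.commute)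
qed

lemma rms_saw_sum_quasi_additive_le:
  "rms (q ^ (b + c)) (\<lambda>n. saw_sum a (b + c) (real n)
      - (saw_sum a b (real (n mod q ^ b)) + saw_sum a c (real (n div q ^ b)))) \<le> 5 * sqrt (real a)"
  using rms_saw_sum_div_le[of "q ^ b" c a] by (simp add: saw_sum_add saw_sum_mod power_add)

lemma saw_sum_rescaled:
  "saw_sum a b (real n / real D) = (\<Sum>l<b. saw (real (a * q ^ l) * real n / real (D * q ^ b)))"
  by (simp add: saw_sum_rev)

lemma sum_power_ratio_le_1: "(\<Sum>l<b. real q ^ l / real q ^ b) \<le> 1"
proof -
  have "(\<Sum>l<b. real q ^ l) * 1 \<le> (\<Sum>l<b. real q ^ l) * (real q - 1)"
    using base_ge_2 by (intro mult_left_mono sum_nonneg) auto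
  also have "\<dots> = real q ^ b - 1" by (metis mult.commute power_diff_1_eq)
  finally show ?thesis using base_pos by (simp add: divide_le_eq flip: sum_divide_distrib)
qed

lemma abs_avg_saw_sum_le:
  assumes "a > 0"
  shows "\<bar>avg (q ^ b) (\<lambda>n. saw_sum a b (real n))\<bar> \<le> 1 + 5 * sqrt (real a)"
proof -
  let ?m = "a * q ^ b"
  let ?fine = "\<lambda>n. saw_sum a b (real n / real a)" and ?coarse = "\<lambda>n. saw_sum a b (real (n div a))"
  have "avg ?m ?fine = (\<Sum>l<b. - real (a * q ^ l) / (2 * real ?m))"
    unfolding saw_sum_rescaled avg_sum
    using assms by (intro sum.cong refl avg_saw) (simp_all add: le_imp_power_dvd)
  also have "\<dots> = - (\<Sum>l<b. real q ^ l / real q ^ b) / 2"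
    using assms by (simp add: sum_divide_distrib sum_negf mult.commute)
  finally have "\<bar>avg ?m ?fine\<bar> \<le> 1"
    using sum_power_ratio_le_1[of b] by (simp add: sum_nonneg)
  moreover have "\<bar>avg ?m (\<lambda>n. ?fine n - ?coarse n)\<bar> \<le> 5 * sqrt (real a)"
    using abs_avg_le_rms rms_saw_sum_div_le[OF assms] by (rule order_trans)
  moreover have "avg ?m ?coarse = avg (q ^ b) (\<lambda>n. saw_sum a b (real n))"
    using assms by (rule avg_div)
  ultimately show ?thesis unfolding avg_diff by linarith
qed

subsection \<open>Asymptotic covariances\<close>

text \<open>\<open>cross_corr a b d\<close> is the mean value of \<open>saw (a x) saw (b q ^ d x)\<close> over \<open>0 \<le> x \<le> 1\<close>.\<close>

definition cross_corr :: "nat \<Rightarrow> nat \<Rightarrow> nat \<Rightarrow> real" where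
  "cross_corr a b d = (real (gcd a (b * q ^ d)))\<^sup>2 / (12 * real a * real b * real q ^ d)"

definition saw_cov :: "nat \<Rightarrow> nat \<Rightarrow> real" where
  "saw_cov a b = (\<Sum>d. cross_corr a b d) + (\<Sum>d. cross_corr b a (Suc d))"

lemma gcd_mult_powers_eq_toeplitz:
  "(real (gcd (a * q ^ l) (b * q ^ m)))\<^sup>2 / (12 * real (a * q ^ l) * real (b * q ^ m))
    = toeplitz (cross_corr a b) (cross_corr b a) l m"
proof -
  have ordered: "(real (gcd (a * q ^ l) (b * q ^ m)))\<^sup>2 / (12 * real (a * q ^ l) * real (b * q ^ m))
      = cross_corr a b (m - l)" if "l \<le> m" for a b l m
  proof -
    have power_split: "q ^ m = q ^ l * q ^ (m - l)" using that by (simp flip: power_add)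
    have "gcd (a * q ^ l) (b * q ^ m) = q ^ l * gcd a (b * q ^ (m - l))"
      unfolding power_split by (metis gcd_mult_distrib_nat mult.commute mult.left_commute)
    then show ?thesis
      unfolding cross_corr_def power_split by (simp add: power2_eq_square)
  qed
  show ?thesis
    using ordered[of l m a b] ordered[of m l b a] by (auto simp: toeplitz_def gcd.commute ac_simps)
qed

lemma summable_cross_corr: "summable (cross_corr a b)"
proof (rule summable_comparison_test')
  show "summable (\<lambda>d. (real a)\<^sup>2 / (12 * real a * real b) * (1 / real q) ^ d)"
    using base_ge_2 by (intro summable_mult summable_geometric) auto
  show "norm (cross_corr a b d) \<le> (real a)\<^sup>2 / (12 * real a * real b) * (1 / real q) ^ d" for d
  proof (cases "a = 0")
    case False
    then have "(real (gcd a (b * q ^ d)))\<^sup>2 \<le> (real a)\<^sup>2"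
      by (intro power_mono) (simp_all add: gcd_le1_nat)
    then have "cross_corr a b d \<le> (real a)\<^sup>2 / (12 * real a * real b * real q ^ d)"
      unfolding cross_corr_def by (intro divide_right_mono) auto
    then show ?thesis by (simp add: cross_corr_def power_divide)
  qed (simp add: cross_corr_def)
qed

lemma cross_corr_0: "cross_corr a b 0 = (real (gcd a b))\<^sup>2 / (12 * real a * real b)"
  by (simp add: cross_corr_def)

lemma saw_cov_commute: "saw_cov a b = saw_cov b a"
  unfolding saw_cov_def suminf_split_head[OF summable_cross_corr] cross_corr_0
  by (simp add: gcd.commute ac_simps)

lemma avg_saw_sum_mult_rescaled:
  assumes "D > 0" "a dvd D" "b dvd D"
  shows "avg (D * q ^ k) (\<lambda>n. saw_sum a k (real n / real D) * saw_sum b k (real n / real D))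
    = (\<Sum>l<k. \<Sum>m<k. toeplitz (cross_corr a b) (cross_corr b a) l m)
      + real a * real b / (6 * (real D)\<^sup>2) * (\<Sum>l<k. real q ^ l / real q ^ k)\<^sup>2"
proof -
  let ?K = "D * q ^ k" and ?c = "real a * real b / (6 * (real D)\<^sup>2)"
  have "avg ?K (\<lambda>n. saw_sum a k (real n / real D) * saw_sum b k (real n / real D))
      = (\<Sum>l<k. \<Sum>m<k. avg ?K (\<lambda>n. saw (real (a * q ^ l) * real n / real ?K)
          * saw (real (b * q ^ m) * real n / real ?K)))"
    unfolding saw_sum_rescaled sum_product avg_sum ..
  also have "\<dots> = (\<Sum>l<k. \<Sum>m<k. toeplitz (cross_corr a b) (cross_corr b a) l m
      + ?c * (real q ^ l / real q ^ k * (real q ^ m / real q ^ k)))"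
  proof (intro sum.cong refl)
    fix l m assume "l \<in> {..<k}" "m \<in> {..<k}"
    then have "a * q ^ l dvd ?K" "b * q ^ m dvd ?K"
      using assms by (auto intro!: mult_dvd_mono le_imp_power_dvd)
    then show "avg ?K (\<lambda>n. saw (real (a * q ^ l) * real n / real ?K)
        * saw (real (b * q ^ m) * real n / real ?K))
      = toeplitz (cross_corr a b) (cross_corr b a) l m
        + ?c * (real q ^ l / real q ^ k * (real q ^ m / real q ^ k))"
      using assms(1) unfolding gcd_mult_powers_eq_toeplitz[symmetric]
      by (subst avg_saw_mult_saw) (simp_all add: power2_eq_square ac_simps)
  qed
  also have "\<dots> = (\<Sum>l<k. \<Sum>m<k. toeplitz (cross_corr a b) (cross_corr b a) l m)
      + ?c * (\<Sum>l<k. real q ^ l / real q ^ k)\<^sup>2"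
    unfolding power2_eq_square[of "\<Sum>l<k. _ l"] sum_product unfolding sum_distrib_left sum.distrib ..
  finally show ?thesis .
qed

lemma avg_saw_sum_mult_rescaled_tendsto:
  assumes "D > 0" "a dvd D" "b dvd D"
  shows "(\<lambda>k. avg (D * q ^ k)
      (\<lambda>n. saw_sum a k (real n / real D) * saw_sum b k (real n / real D)) / real k)
    \<longlonglongrightarrow> saw_cov a b"
proof -
  let ?c = "real a * real b / (6 * (real D)\<^sup>2)"
  have "(\<lambda>k. ?c * (\<Sum>l<k. real q ^ l / real q ^ k)\<^sup>2 / real k) \<longlonglongrightarrow> 0"
  proof (rule Lim_null_comparison)
    have "(\<Sum>l<k. real q ^ l / real q ^ k)\<^sup>2 \<le> 1" for k
      using sum_power_ratio_le_1[of k] by (simp add: abs_square_le_1 sum_nonneg)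
    then have "norm (?c * (\<Sum>l<k. real q ^ l / real q ^ k)\<^sup>2) \<le> ?c * 1" for k
      unfolding norm_mult by (intro mult_mono) simp_all
    then show "\<forall>\<^sub>F k in sequentially.
        norm (?c * (\<Sum>l<k. real q ^ l / real q ^ k)\<^sup>2 / real k) \<le> ?c * 1 / real k"
      by (intro always_eventually allI)
        (simp only: norm_divide norm_of_nat divide_right_mono of_nat_0_le_iff)
  qed (rule lim_const_over_n)
  moreover have "(\<lambda>k. (\<Sum>l<k. \<Sum>m<k. toeplitz (cross_corr a b) (cross_corr b a) l m) / real k)
      \<longlonglongrightarrow> saw_cov a b"
    unfolding saw_cov_def
    by (intro toeplitz_sum_over_tendsto summable_sums)
      (simp_all add: summable_cross_corr summable_Suc_iff)
  ultimately show ?thesis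
    unfolding avg_saw_sum_mult_rescaled[OF assms] add_divide_distrib
    using tendsto_add by fastforce
qed

subsection \<open>Linear combinations\<close>

definition saw_comb :: "('d::finite \<Rightarrow> nat) \<Rightarrow> ('d \<Rightarrow> real) \<Rightarrow> nat \<Rightarrow> real \<Rightarrow> real" where
  "saw_comb A t b x = (\<Sum>i\<in>UNIV. t i * saw_sum (A i) b x)"

definition saw_form :: "('d::finite \<Rightarrow> nat) \<Rightarrow> ('d \<Rightarrow> real) \<Rightarrow> real" where
  "saw_form A t = (\<Sum>i\<in>UNIV. \<Sum>j\<in>UNIV. t i * t j * saw_cov (A i) (A j))"

lemma saw_comb_diff:
  "saw_comb A t b x - saw_comb A t b y
    = (\<Sum>i\<in>UNIV. t i * (saw_sum (A i) b x - saw_sum (A i) b y))"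
  by (simp add: saw_comb_def sum_subtractf right_diff_distrib)

lemma quasi_additive_saw_comb:
  "quasi_additive q (\<lambda>b n. saw_comb A t b (real n)) (\<Sum>i\<in>UNIV. \<bar>t i\<bar> * (5 * sqrt (real (A i))))"
proof
  fix b c
  have "(\<lambda>n. saw_comb A t (b + c) (real n)
      - (saw_comb A t b (real (n mod q ^ b)) + saw_comb A t c (real (n div q ^ b))))
    = (\<lambda>n. \<Sum>i\<in>UNIV. t i * (saw_sum (A i) (b + c) (real n)
      - (saw_sum (A i) b (real (n mod q ^ b)) + saw_sum (A i) c (real (n div q ^ b)))))"
    by (simp add: saw_comb_def sum_subtractf sum.distrib algebra_simps)
  then show "rms (q ^ (b + c)) (\<lambda>n. saw_comb A t (b + c) (real n)
      - (saw_comb A t b (real (n mod q ^ b)) + saw_comb A t c (real (n div q ^ b))))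
    \<le> (\<Sum>i\<in>UNIV. \<bar>t i\<bar> * (5 * sqrt (real (A i))))"
    by (simp only:) (intro rms_sum_mult_le rms_saw_sum_quasi_additive_le)
qed

lemma abs_avg_saw_comb_le:
  assumes "\<And>i. A i > 0"
  shows "\<bar>avg (q ^ b) (\<lambda>n. saw_comb A t b (real n))\<bar>
    \<le> (\<Sum>i\<in>UNIV. \<bar>t i\<bar> * (1 + 5 * sqrt (real (A i))))"
  unfolding saw_comb_def avg_sum avg_mult_left
  by (intro order_trans[OF sum_abs sum_mono])
    (simp only: abs_mult mult_left_mono abs_ge_zero abs_avg_saw_sum_le assms)

lemma avg_saw_comb_power2_tendsto:
  assumes A_pos: "\<And>i. A i > 0"
  shows "(\<lambda>b. avg (q ^ b) (\<lambda>n. (saw_comb A t b (real n))\<^sup>2) / real b) \<longlonglongrightarrow> saw_form A t"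
proof -
  define D where "D = (\<Prod>i\<in>UNIV. A i)"
  have common_multiple: "D > 0" "A i dvd D" for i
    using A_pos by (auto simp: D_def prod_pos intro: dvd_prodI)
  let ?fine = "\<lambda>b n. saw_comb A t b (real n / real D)"
  have "(\<lambda>b. (rms (q ^ b) (\<lambda>n. saw_comb A t b (real n)))\<^sup>2 / real b) \<longlonglongrightarrow> saw_form A t"
  proof (rule power2_over_tendsto_if_bounded_diff)
    show "\<bar>rms (q ^ b) (\<lambda>n. saw_comb A t b (real n)) - rms (D * q ^ b) (?fine b)\<bar>
      \<le> (\<Sum>i\<in>UNIV. \<bar>t i\<bar> * (5 * sqrt (real (A i))))" for b
    proof -
      have "rms (q ^ b) (\<lambda>n. saw_comb A t b (real n))
          = rms (D * q ^ b) (\<lambda>n. saw_comb A t b (real (n div D)))"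
        using common_multiple(1) by (rule rms_div[symmetric])
      then have "\<bar>rms (q ^ b) (\<lambda>n. saw_comb A t b (real n)) - rms (D * q ^ b) (?fine b)\<bar>
          \<le> rms (D * q ^ b) (\<lambda>n. ?fine b n - saw_comb A t b (real (n div D)))"
        using abs_rms_diff_le[of "D * q ^ b" "?fine b" "\<lambda>n. saw_comb A t b (real (n div D))"]
        by (simp only: abs_minus_commute)
      also have "\<dots> \<le> (\<Sum>i\<in>UNIV. \<bar>t i\<bar> * (5 * sqrt (real (A i))))"
        unfolding saw_comb_diff by (intro rms_sum_mult_le rms_saw_sum_div_le common_multiple)
      finally show ?thesis .
    qed
    have "(\<lambda>b. \<Sum>i\<in>UNIV. \<Sum>j\<in>UNIV. t i * t j * (avg (D * q ^ b)
        (\<lambda>n. saw_sum (A i) b (real n / real D) * saw_sum (A j) b (real n / real D)) / real b))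
      \<longlonglongrightarrow> saw_form A t"
      unfolding saw_form_def
      by (intro tendsto_sum tendsto_mult tendsto_const avg_saw_sum_mult_rescaled_tendsto
        common_multiple)
    moreover have "(rms (D * q ^ b) (?fine b))\<^sup>2 = (\<Sum>i\<in>UNIV. \<Sum>j\<in>UNIV. t i * t j * avg (D * q ^ b)
        (\<lambda>n. saw_sum (A i) b (real n / real D) * saw_sum (A j) b (real n / real D)))" for b
      unfolding rms_power2 unfolding power2_eq_square saw_comb_def sum_product
        avg_mult_left[symmetric] avg_sum[symmetric] by (simp only: ac_simps)
    ultimately show "(\<lambda>b. (rms (D * q ^ b) (?fine b))\<^sup>2 / real b) \<longlonglongrightarrow> saw_form A t"
      by (simp add: sum_divide_distrib)
  qed simp
  then show ?thesis by (simp add: rms_power2)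
qed

lemma saw_form_nonneg:
  assumes "\<And>i. A i > 0"
  shows "0 \<le> saw_form A t"
  by (rule LIMSEQ_le_const[OF avg_saw_comb_power2_tendsto[OF assms]])
    (auto intro!: divide_nonneg_nonneg avg_nonneg)

section \<open>Sums of digits\<close>

lemma digit_sum_eq_sum_lessThan:
  assumes "m < q ^ k"
  shows "digit_sum q m = (\<Sum>l<k. digit q l m)"
  unfolding digit_sum_def
proof (rule sum.mono_neutral_left)
  show "{l. digit q l m \<noteq> 0} \<subseteq> {..<k}"
  proof (rule subsetI, rule ccontr)
    fix l assume l_support: "l \<in> {l. digit q l m \<noteq> 0}" and "l \<notin> {..<k}"
    then have "q ^ k \<le> q ^ l" by (intro power_increasing) (simp_all add: Suc_le_eq)
    with assms have "m div q ^ l = 0" by simp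
    with l_support show False by (simp add: digit_def)
  qed
qed auto

lemma sum_digit_eq_frac:
  "real (\<Sum>l<k. digit q l m)
    = (real q - 1) * (\<Sum>l=1..k. frac (real m / real q ^ l)) + frac (real m / real q ^ k)"
proof (induction k)
  case (Suc k)
  have frac_eq: "frac (real m / real q ^ l) = real (m mod q ^ l) / real q ^ l" for l
  proof -
    have "frac (real m / real q ^ l) = frac (real (m mod q ^ l) / real q ^ l)"
      using saw_of_nat_mod[of "q ^ l" "q ^ l" m] by (simp add: saw_def)
    then show ?thesis by (simp flip: of_nat_power)
  qed
  have "m mod q ^ Suc k = q ^ k * digit q k m + m mod q ^ k"
    unfolding digit_def power_Suc2 by (rule mod_mult2_eq)
  then have "real (m mod q ^ Suc k) = real q ^ k * real (digit q k m) + real (m mod q ^ k)"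
    by (metis of_nat_add of_nat_mult of_nat_power)
  then have "real q * frac (real m / real q ^ Suc k)
      = real (digit q k m) + frac (real m / real q ^ k)"
    unfolding frac_eq by (simp add: field_simps)
  then show ?case using Suc by (simp add: algebra_simps)
qed simp

lemma abs_digit_sum_diff_saw_sum_le:
  assumes n_less: "n < q ^ (M + B)"
  shows "\<bar>real (digit_sum q (a * n))
      - (real q - 1) * (saw_sum a M (real (n mod q ^ M)) + real M / 2)\<bar>
    \<le> 1 + real q * (real B + real a)"
proof -
  have "a \<le> q ^ a"
    using less_exp[of a] power_mono[OF base_ge_2 zero_le, of a] by linarith
  then have "a * n \<le> q ^ a * n" by (rule mult_le_mono1)
  also have "\<dots> < q ^ a * q ^ (M + B)" using n_less by simp
  finally have "digit_sum q (a * n) = (\<Sum>l<M + (B + a). digit q l (a * n))"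
    by (intro digit_sum_eq_sum_lessThan) (simp add: power_add ac_simps)
  also have "\<dots> = (\<Sum>l<M. digit q l (a * n)) + (\<Sum>l=M..<M+(B+a). digit q l (a * n))"
    using sum.atLeastLessThan_concat[of 0 M "M+(B+a)" "\<lambda>l. digit q l (a * n)"]
    by (simp add: atLeast0LessThan)
  finally have "real (digit_sum q (a * n))
      = real (\<Sum>l<M. digit q l (a * n)) + real (\<Sum>l=M..<M+(B+a). digit q l (a * n))"
    by simp
  moreover have "(\<Sum>l=M..<M+(B+a). digit q l (a * n)) \<le> (\<Sum>l=M..<M+(B+a). q)"
    by (intro sum_mono) (simp add: digit_def less_imp_le)
  then have "real (\<Sum>l=M..<M+(B+a). digit q l (a * n)) \<le> real q * (real B + real a)"
    by (simp add: mult.commute flip: of_nat_mult of_nat_add of_nat_sum)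
  moreover have "(\<Sum>l=1..M. frac (real (a * n) / real q ^ l))
      = saw_sum a M (real (n mod q ^ M)) + real M / 2"
    unfolding saw_sum_mod by (simp add: saw_sum_def saw_def sum_subtractf)
  then have "real (\<Sum>l<M. digit q l (a * n))
      = (real q - 1) * (saw_sum a M (real (n mod q ^ M)) + real M / 2)
        + frac (real (a * n) / real q ^ M)"
    unfolding sum_digit_eq_frac by simp
  ultimately show ?thesis
    using frac_lt_1[of "real (a * n) / real q ^ M"] frac_ge_0[of "real (a * n) / real q ^ M"]
      of_nat_0_le_iff[of "\<Sum>l=M..<M+(B+a). digit q l (a * n)", where 'a = real]
    by linarith
qed

definition digit_cov :: "nat \<Rightarrow> nat \<Rightarrow> real" where
  "digit_cov a b = (real q - 1)\<^sup>2 * saw_cov a b"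

lemma digit_cov_prime:
  assumes "prime q" "\<not> q dvd a" "\<not> q dvd b"
  shows "digit_cov a b = ((real q)\<^sup>2 - 1) / 12 * ((real (gcd a b))\<^sup>2 / (real a * real b))"
proof -
  define z where "z = 1 / real q"
  have z_props: "norm z < 1" "real q = 1 / z" using base_ge_2 by (simp_all add: z_def)
  have corr: "cross_corr a b d = cross_corr a b 0 * z ^ d" if "\<not> q dvd a" for a b d
  proof -
    have "coprime a (q ^ d)"
      using prime_imp_coprime[OF assms(1) that] by (simp add: coprime_commute)
    then show ?thesis
      by (simp add: z_def cross_corr_def gcd_mult_right_right_cancel power_divide)
  qed
  have "cross_corr a b sums (cross_corr a b 0 * (1 / (1 - z)))"
    using sums_mult[OF geometric_sums[OF z_props(1)], of "cross_corr a b 0"]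
    by (simp only: corr[OF assms(2), symmetric])
  moreover have "(\<lambda>d. cross_corr b a (Suc d)) sums (cross_corr b a 0 * z * (1 / (1 - z)))"
    using sums_mult[OF geometric_sums[OF z_props(1)], of "cross_corr b a 0 * z"]
    by (simp only: mult.assoc[of _ z] power_Suc[symmetric] corr[OF assms(3), symmetric])
  moreover have "cross_corr b a 0 = cross_corr a b 0"
    by (simp add: cross_corr_0 gcd.commute ac_simps)
  ultimately have "saw_cov a b = cross_corr a b 0 * ((1 + z) / (1 - z))"
    by (simp add: saw_cov_def sums_iff distrib_left add_divide_distrib)
  also have "(1 + z) / (1 - z) = (real q + 1) / (real q - 1)"
    using base_ge_2 by (simp add: z_def field_simps)
  finally have "digit_cov a b = ((real q)\<^sup>2 - 1) * cross_corr a b 0"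
    unfolding digit_cov_def using base_ge_2 by (simp add: power2_eq_square field_simps)
  then show ?thesis by (simp add: cross_corr_0)
qed

definition digit_form :: "('d::finite \<Rightarrow> nat) \<Rightarrow> ('d \<Rightarrow> real) \<Rightarrow> real" where
  "digit_form A t = (\<Sum>i\<in>UNIV. \<Sum>j\<in>UNIV. t i * t j * digit_cov (A i) (A j))"

lemma digit_form_eq_saw_form: "digit_form A t = saw_form A (\<lambda>i. (real q - 1) * t i)"
  unfolding digit_form_def saw_form_def digit_cov_def
  by (simp add: power2_eq_square ac_simps)

theorem avg_cis_digit_sums_tendsto:
  fixes A :: "'d::finite \<Rightarrow> nat"
  assumes A_pos: "\<And>i. A i > 0"
  shows "(\<lambda>N. avg N (\<lambda>n. cis (\<Sum>i\<in>UNIV. t i *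
      ((real (digit_sum q (A i * n)) - (real q - 1) / 2 * log q N) / sqrt (log q N)))))
    \<longlonglongrightarrow> of_real (exp (- (digit_form A t / 2)))"
proof -
  define t' where "t' i = (real q - 1) * t i" for i
  define X where "X n = (\<Sum>i\<in>UNIV. t i * real (digit_sum q (A i * n)))" for n
  define \<mu> where "\<mu> = (\<Sum>i\<in>UNIV. t i * ((real q - 1) / 2))"
  interpret quasi_additive q "\<lambda>b n. saw_comb A t' b (real n)"
    "\<Sum>i\<in>UNIV. \<bar>t' i\<bar> * (5 * sqrt (real (A i)))"
    by (rule quasi_additive_saw_comb)
  note moments = abs_avg_saw_comb_le[OF A_pos] avg_saw_comb_power2_tendsto[OF A_pos]
  have "(\<lambda>N. avg N (\<lambda>n. cis ((X n - \<mu> * log q N) / sqrt (log q N))))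
    \<longlonglongrightarrow> of_real (exp (- (saw_form A t' / 2)))"
  proof (rule avg_cis_normalized_tendsto[OF moments])
    fix n M B assume n_less: "n < q ^ (M + B)"
    have "X n - \<mu> * real M - saw_comb A t' M (real (n mod q ^ M))
      = (\<Sum>i\<in>UNIV. t i * (real (digit_sum q (A i * n))
          - (real q - 1) * (saw_sum (A i) M (real (n mod q ^ M)) + real M / 2)))"
      unfolding X_def \<mu>_def saw_comb_def t'_def sum_distrib_right sum_subtractf[symmetric]
      by (intro sum.cong refl) (simp add: field_simps)
    also have "\<bar>\<dots>\<bar> \<le> (\<Sum>i\<in>UNIV. \<bar>t i\<bar> * (1 + real q * (real B + real (A i))))"
      by (intro order_trans[OF sum_abs sum_mono])
        (simp only: abs_mult mult_left_mono abs_ge_zero abs_digit_sum_diff_saw_sum_le[OF n_less])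
    also have "\<dots> \<le> (\<Sum>i\<in>UNIV. \<bar>t i\<bar> * ((1 + real q * (1 + real (A i))) * (1 + real B)))"
      by (intro sum_mono mult_left_mono) (simp_all add: algebra_simps)
    finally show "\<bar>X n - \<mu> * real M - saw_comb A t' M (real (n mod q ^ M))\<bar>
      \<le> (\<Sum>i\<in>UNIV. \<bar>t i\<bar> * (1 + real q * (1 + real (A i)))) * (1 + real B)"
      by (simp only: sum_distrib_right mult.assoc)
  qed
  moreover have "(X n - \<mu> * L) / s
      = (\<Sum>i\<in>UNIV. t i * ((real (digit_sum q (A i * n)) - (real q - 1) / 2 * L) / s))" for n L s
    unfolding X_def \<mu>_def sum_distrib_right sum_subtractf[symmetric] sum_divide_distrib
    by (intro sum.cong refl) (simp add: right_diff_distrib mult.assoc)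
  ultimately show ?thesis
    by (simp add: digit_form_eq_saw_form t'_def[abs_def])
qed

end

section \<open>Weak convergence from characteristic functions\<close>

locale borel_distribution = prob_space M for M :: "'a::topological_space measure" +
  assumes sets_eq_borel [simp, measurable_cong]: "sets M = sets borel"
begin

lemma borel_measurable_continuous:
  fixes g :: "'a \<Rightarrow> 'b::topological_space"
  assumes "continuous_on UNIV g"
  shows "g \<in> borel_measurable M"
  using borel_measurable_continuous_onI[OF assms] by simp

lemma integrable_bounded_continuous:
  fixes g :: "'a \<Rightarrow> 'b::{banach, second_countable_topology}"
  assumes "continuous_on UNIV g" and "\<And>x. norm (g x) \<le> B"
  shows "integrable M g"
  by (rule integrable_const_bound[of _ B]) (auto intro: borel_measurable_continuous assms)

end

definition charfun :: "'a::real_inner measure \<Rightarrow> 'a \<Rightarrow> complex" where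
  "charfun M t = (\<integral>x. cis (t \<bullet> x) \<partial>M)"

subsection \<open>Trigonometric polynomials\<close>

inductive trig_poly :: "('a::real_inner \<Rightarrow> real) \<Rightarrow> bool" where
  cos: "trig_poly (\<lambda>x. c * cos (t \<bullet> x + a))"
| add: "trig_poly f \<Longrightarrow> trig_poly g \<Longrightarrow> trig_poly (\<lambda>x. f x + g x)"

lemma trig_poly_const: "trig_poly (\<lambda>x. c)"
  using trig_poly.cos[of c 0 0] by simp

lemma trig_poly_mult:
  assumes "trig_poly f" "trig_poly g"
  shows "trig_poly (\<lambda>x. f x * g x)"
  using assms(1)
proof induction
  case (cos c t a)
  show ?case using assms(2)
  proof induction
    case (cos c' t' a')
    have "c * cos (t \<bullet> x + a) * (c' * cos (t' \<bullet> x + a')) =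
      c * c' / 2 * cos ((t - t') \<bullet> x + (a - a')) + c * c' / 2 * cos ((t + t') \<bullet> x + (a + a'))" for x
    proof -
      have "cos (t \<bullet> x + a) * cos (t' \<bullet> x + a')
        = (cos ((t - t') \<bullet> x + (a - a')) + cos ((t + t') \<bullet> x + (a + a'))) / 2"
        unfolding cos_times_cos by (simp add: inner_diff_left inner_add_left algebra_simps)
      then show ?thesis by (simp add: field_simps)
    qed
    then show ?case by (simp only:) (intro trig_poly.intros)
  next
    case (add f g)
    then show ?case by (simp only: distrib_left) (rule trig_poly.add)
  qed
next
  case (add f g)
  then show ?case by (simp only: distrib_right) (rule trig_poly.add)
qed

lemma trig_poly_sum: "finite I \<Longrightarrow> (\<And>i. i \<in> I \<Longrightarrow> trig_poly (f i)) \<Longrightarrow> trig_poly (\<lambda>x. \<Sum>i\<in>I. f i x)"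
  by (induction I rule: finite_induct) (auto intro: trig_poly_const trig_poly.add)

lemma integrable_cos_inner:
  assumes "borel_distribution M"
  shows "integrable M (\<lambda>x. c * cos (t \<bullet> x + a))"
  by (rule borel_distribution.integrable_bounded_continuous[OF assms, of _ "\<bar>c\<bar>"])
    (auto intro!: continuous_intros mult_left_le simp: abs_mult)

lemma integral_cos_inner:
  assumes "borel_distribution M"
  shows "(\<integral>x. c * cos (t \<bullet> x + a) \<partial>M) = c * Re (cis a * charfun M t)"
proof -
  interpret borel_distribution M by fact
  have cis: "integrable M (\<lambda>x. cis (t \<bullet> x))"
    by (rule integrable_bounded_continuous[of _ 1]) (auto intro!: continuous_intros)
  have "(\<integral>x. c * cos (t \<bullet> x + a) \<partial>M) = c * (\<integral>x. Re (cis a * cis (t \<bullet> x)) \<partial>M)"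
    by (simp add: cis_mult add.commute)
  also have "\<dots> = c * Re (\<integral>x. cis a * cis (t \<bullet> x) \<partial>M)"
    using integral_Re[OF integrable_mult_right[OF cis, of "cis a"]] by simp
  finally show ?thesis by (simp add: charfun_def)
qed

lemma integrable_trig_poly:
  assumes "borel_distribution M" "trig_poly f"
  shows "integrable M f"
  using assms(2)
proof induction
  case (cos c t a)
  show ?case by (rule integrable_cos_inner[OF assms(1)])
qed simp

lemma trig_poly_integral_tendsto:
  assumes M_borel: "\<And>n. borel_distribution (M n)" and \<mu>_borel: "borel_distribution \<mu>"
    and conv: "\<And>t. (\<lambda>n. charfun (M n) t) \<longlonglongrightarrow> charfun \<mu> t"
    and "trig_poly f"
  shows "(\<lambda>n. \<integral>x. f x \<partial>M n) \<longlonglongrightarrow> (\<integral>x. f x \<partial>\<mu>)"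
  using assms(4)
proof induction
  case (cos c t a)
  show ?case
    unfolding integral_cos_inner[OF M_borel] integral_cos_inner[OF \<mu>_borel]
    by (intro tendsto_intros conv)
next
  case (add f g)
  then show ?case
    by (simp add: integrable_trig_poly[OF M_borel] integrable_trig_poly[OF \<mu>_borel] tendsto_add)
qed

text \<open>Unlike a polynomial in the coordinates, a polynomial in \<open>sin (x\<^sub>b / T)\<close> is bounded on the
  whole space; on a box of half-width \<open>\<pi> T / 2\<close> no information is lost.\<close>

definition fold_sin :: "real \<Rightarrow> 'a::euclidean_space \<Rightarrow> 'a" where
  "fold_sin T x = (\<Sum>b\<in>Basis. sin (x \<bullet> b / T) *\<^sub>R b)"

definition unfold_sin :: "real \<Rightarrow> 'a::euclidean_space \<Rightarrow> 'a" where
  "unfold_sin T y = (\<Sum>b\<in>Basis. (T * arcsin (y \<bullet> b)) *\<^sub>R b)"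

lemma fold_sin_inner: "b \<in> Basis \<Longrightarrow> fold_sin T x \<bullet> b = sin (x \<bullet> b / T)"
  by (simp add: fold_sin_def inner_sum_left inner_Basis if_distrib sum.If_cases cong: if_cong)

lemma fold_sin_in_cbox: "fold_sin T x \<in> cbox (- One) One"
  by (auto simp: mem_box fold_sin_inner)

lemma unfold_sin_fold_sin:
  assumes T_pos: "T > 0" and x_in_box: "\<And>b. b \<in> Basis \<Longrightarrow> \<bar>x \<bullet> b\<bar> \<le> pi / 2 * T"
  shows "unfold_sin T (fold_sin T x) = x"
proof -
  have "T * arcsin (fold_sin T x \<bullet> b) = x \<bullet> b" if b_Basis: "b \<in> Basis" for b
  proof -
    have "- (pi / 2) \<le> x \<bullet> b / T" "x \<bullet> b / T \<le> pi / 2"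
      using x_in_box[OF b_Basis] T_pos by (auto simp: field_simps abs_le_iff)
    then show ?thesis using T_pos b_Basis by (simp add: fold_sin_inner arcsin_sin)
  qed
  then show ?thesis by (simp add: unfold_sin_def euclidean_representation)
qed

lemma continuous_on_unfold_sin: "continuous_on (cbox (- One) One) (unfold_sin T)"
  unfolding unfold_sin_def by (intro continuous_intros) (auto simp: mem_box)

lemma trig_poly_polynomial_fold_sin:
  fixes g :: "'a::euclidean_space \<Rightarrow> real"
  assumes "real_polynomial_function g"
  shows "trig_poly (\<lambda>x. g (fold_sin T x))"
  using assms
proof induction
  case (linear f)
  interpret bounded_linear f by fact
  have "f (fold_sin T x) = (\<Sum>b\<in>Basis. f b * cos ((b /\<^sub>R T) \<bullet> x + (- (pi / 2))))" for x
  proof -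
    have "(b /\<^sub>R T) \<bullet> x = x \<bullet> b / T" for b
      by (simp add: inner_commute divide_inverse)
    moreover have "cos (y + (- (pi / 2))) = sin y" for y :: real
      by (simp add: cos_diff)
    moreover have "f (fold_sin T x) = (\<Sum>b\<in>Basis. sin (x \<bullet> b / T) * f b)"
      by (simp add: fold_sin_def sum scaleR)
    ultimately show ?thesis by (simp only: mult.commute)
  qed
  then have "(\<lambda>x. f (fold_sin T x)) = (\<lambda>x. \<Sum>b\<in>Basis. f b * cos ((b /\<^sub>R T) \<bullet> x + (- (pi / 2))))"
    by (rule ext)
  then show ?case by (simp only:) (intro trig_poly_sum trig_poly.cos finite_Basis)
qed (auto intro: trig_poly_const trig_poly.add trig_poly_mult)

subsection \<open>Tightness\<close>

definition ramp :: "real \<Rightarrow> real \<Rightarrow> real" where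
  "ramp R y = min 1 (max 0 (\<bar>y\<bar> - R))"

lemma ramp_nonneg [simp]: "0 \<le> ramp R y" and ramp_le_1 [simp]: "ramp R y \<le> 1"
  by (auto simp: ramp_def)

lemma continuous_on_ramp [continuous_intros]:
  "continuous_on S f \<Longrightarrow> continuous_on S (\<lambda>x. ramp R (f x))"
  unfolding ramp_def by (intro continuous_intros)

definition tail :: "real \<Rightarrow> 'a::euclidean_space \<Rightarrow> real" where
  "tail R x = (\<Sum>b\<in>Basis. ramp R (x \<bullet> b))"

lemma tail_nonneg: "0 \<le> tail R x"
  by (simp add: tail_def sum_nonneg)

lemma tail_le_DIM: "tail R x \<le> real DIM('a)" for x :: "'a::euclidean_space"
  unfolding tail_def using sum_mono[of Basis "\<lambda>b. ramp R (x \<bullet> b)" "\<lambda>_. 1"] by simp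

lemma tail_ge_1:
  assumes "b \<in> Basis" "R + 1 \<le> \<bar>x \<bullet> b\<bar>"
  shows "1 \<le> tail R x"
proof -
  have "1 = ramp R (x \<bullet> b)" using assms(2) by (simp add: ramp_def)
  also have "\<dots> \<le> tail R x"
    unfolding tail_def using assms(1) by (intro member_le_sum) auto
  finally show ?thesis .
qed

lemma integrable_ramp_inner:
  fixes M :: "'a::euclidean_space measure"
  assumes "borel_distribution M"
  shows "integrable M (\<lambda>x. ramp R (x \<bullet> b))"
  by (rule borel_distribution.integrable_bounded_continuous[OF assms, of _ 1])
    (auto intro!: continuous_intros)

lemma integrable_tail: "borel_distribution M \<Longrightarrow> integrable M (tail R)"
  unfolding tail_def[abs_def] by (intro Bochner_Integration.integrable_sum integrable_ramp_inner)

lemma integral_tail: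
  "borel_distribution M \<Longrightarrow> (\<integral>x. tail R x \<partial>M) = (\<Sum>b\<in>Basis. \<integral>x. ramp R (x \<bullet> b) \<partial>M)"
  unfolding tail_def by (intro Bochner_Integration.integral_sum integrable_ramp_inner)

lemma char_distr_inner:
  assumes "borel_distribution M"
  shows "char (distr M borel (\<lambda>x. t \<bullet> x)) s = charfun M (s *\<^sub>R t)"
proof -
  interpret borel_distribution M by fact
  have [measurable]: "(\<lambda>x. t \<bullet> x) \<in> borel_measurable M"
    by (intro borel_measurable_continuous continuous_intros)
  show ?thesis
    unfolding char_def charfun_def by (subst integral_distr) (auto simp: cis_conv_exp)
qed

lemma real_distribution_distr_inner:
  assumes "borel_distribution M"
  shows "real_distribution (distr M borel (\<lambda>x. t \<bullet> x))"
proof -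
  interpret borel_distribution M by fact
  show ?thesis
    by (intro real_distribution_distr borel_measurable_continuous continuous_intros)
qed

lemma integral_tail_tendsto:
  fixes M :: "nat \<Rightarrow> 'a::euclidean_space measure"
  assumes M_borel: "\<And>n. borel_distribution (M n)" and \<mu>_borel: "borel_distribution \<mu>"
    and conv: "\<And>t. (\<lambda>n. charfun (M n) t) \<longlonglongrightarrow> charfun \<mu> t"
  shows "(\<lambda>n. \<integral>x. tail R x \<partial>M n) \<longlonglongrightarrow> (\<integral>x. tail R x \<partial>\<mu>)"
  unfolding integral_tail[OF M_borel] integral_tail[OF \<mu>_borel]
proof (rule tendsto_sum)
  fix b :: 'a
  let ?law = "\<lambda>\<nu>. distr \<nu> borel (\<lambda>x. b \<bullet> x)"
  have "weak_conv_m (\<lambda>n. ?law (M n)) (?law \<mu>)"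
    by (rule levy_continuity)
      (simp_all add: real_distribution_distr_inner char_distr_inner M_borel \<mu>_borel conv)
  then have "(\<lambda>n. \<integral>y. ramp R y \<partial>?law (M n)) \<longlonglongrightarrow> (\<integral>y. ramp R y \<partial>?law \<mu>)"
  proof (rule weak_conv_imp_integral_bdd_continuous_conv[rotated 2])
    show "isCont (ramp R) y" for y
      using continuous_on_ramp[OF continuous_on_id, of UNIV R]
      by (simp add: continuous_on_eq_continuous_at)
    show "norm (ramp R y) \<le> 1" for y by simp
  qed (simp_all add: real_distribution_distr_inner M_borel \<mu>_borel)
  moreover have "(\<integral>y. ramp R y \<partial>?law \<nu>) = (\<integral>x. ramp R (x \<bullet> b) \<partial>\<nu>)" if "borel_distribution \<nu>" for \<nu>
  proof -
    interpret borel_distribution \<nu> by fact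
    have "ramp R \<in> borel_measurable borel"
      using continuous_on_ramp[OF continuous_on_id, of UNIV R]
      by (simp add: borel_measurable_continuous_onI)
    then show ?thesis by (subst integral_distr) (simp_all add: inner_commute)
  qed
  ultimately show "(\<lambda>n. \<integral>x. ramp R (x \<bullet> b) \<partial>M n) \<longlonglongrightarrow> (\<integral>x. ramp R (x \<bullet> b) \<partial>\<mu>)"
    by (simp add: M_borel \<mu>_borel)
qed

lemma integral_tail_tendsto_0:
  fixes M :: "'a::euclidean_space measure"
  assumes "borel_distribution M"
  shows "(\<lambda>R. \<integral>x. tail (real R) x \<partial>M) \<longlonglongrightarrow> 0"
proof -
  interpret borel_distribution M by fact
  have "(\<lambda>R. \<integral>x. tail (real R) x \<partial>M) \<longlonglongrightarrow> (\<integral>x. 0 \<partial>M)"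
  proof (rule integral_dominated_convergence[where w = "\<lambda>_. real DIM('a)"])
    show "tail (real R) \<in> borel_measurable M" for R
      by (rule borel_measurable_integrable[OF integrable_tail[OF assms]])
    show "AE x in M. norm (tail (real R) x) \<le> real DIM('a)" for R
      by (simp add: tail_nonneg tail_le_DIM)
    show "AE x in M. (\<lambda>R. tail (real R) x) \<longlonglongrightarrow> 0"
    proof (intro AE_I2)
      fix x :: 'a
      obtain R0 where norm_less: "norm x < real R0" using reals_Archimedean2 by blast
      have "tail (real R) x = 0" if "R \<ge> R0" for R
      proof -
        have "\<bar>x \<bullet> b\<bar> \<le> real R" if "b \<in> Basis" for b
          using Basis_le_norm[OF that, of x] norm_less \<open>R \<ge> R0\<close> by linarith
        then show ?thesis by (simp add: tail_def ramp_def)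
      qed
      then show "(\<lambda>R. tail (real R) x) \<longlonglongrightarrow> 0"
        by (intro tendsto_eventually eventually_sequentiallyI)
    qed
  qed auto
  then show ?thesis by simp
qed

subsection \<open>The continuity theorem\<close>

lemma trig_poly_approximation:
  fixes f :: "'a::euclidean_space \<Rightarrow> real"
  assumes f_continuous: "continuous_on UNIV f" and f_bounded: "\<And>x. \<bar>f x\<bar> \<le> B"
    and \<delta>_range: "0 < \<delta>" "\<delta> \<le> 1" and R_nonneg: "0 \<le> R"
  obtains h where "trig_poly h" "\<And>x. \<bar>f x - h x\<bar> \<le> \<delta> + (2 * B + 1) * tail R x"
proof -
  define T where "T = (R + 1) / (pi / 2)"
  have T_props: "T > 0" "pi / 2 * T = R + 1" using R_nonneg by (simp_all add: T_def)
  have "continuous_on (cbox (- One) One) (\<lambda>y. f (unfold_sin T y))"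
    by (intro continuous_on_compose2[OF f_continuous] continuous_on_unfold_sin) auto
  from Stone_Weierstrass_real_polynomial_function[OF compact_cbox this \<delta>_range(1)]
  obtain g where g_polynomial: "real_polynomial_function g"
    and g_close: "\<And>y. y \<in> cbox (- One) One \<Longrightarrow> \<bar>f (unfold_sin T y) - g y\<bar> < \<delta>"
    by blast
  have B_nonneg: "0 \<le> B" using f_bounded[of 0] by linarith
  have "\<bar>f x - g (fold_sin T x)\<bar> \<le> \<delta> + (2 * B + 1) * tail R x" for x
  proof (cases "\<forall>b\<in>Basis. \<bar>x \<bullet> b\<bar> \<le> R + 1")
    case True
    then have "unfold_sin T (fold_sin T x) = x"
      using T_props by (intro unfold_sin_fold_sin) auto
    then have "\<bar>f x - g (fold_sin T x)\<bar> < \<delta>"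
      using g_close[OF fold_sin_in_cbox[of T x]] by simp
    moreover have "0 \<le> (2 * B + 1) * tail R x"
      using B_nonneg tail_nonneg by (intro mult_nonneg_nonneg) auto
    ultimately show ?thesis by linarith
  next
    case False
    then obtain b where "b \<in> Basis" "R + 1 \<le> \<bar>x \<bullet> b\<bar>" by force
    then have "1 \<le> tail R x" by (rule tail_ge_1)
    have "\<bar>f x - g (fold_sin T x)\<bar> \<le> 2 * B + 1"
      using f_bounded[of x] f_bounded[of "unfold_sin T (fold_sin T x)"]
        g_close[OF fold_sin_in_cbox[of T x]] \<delta>_range by linarith
    also have "\<dots> \<le> (2 * B + 1) * tail R x"
      using B_nonneg mult_left_mono[OF \<open>1 \<le> tail R x\<close>, of "2 * B + 1"] by simp
    finally show ?thesis using \<delta>_range(1) by linarith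
  qed
  with trig_poly_polynomial_fold_sin[OF g_polynomial] show thesis by (rule that)
qed

lemma abs_integral_diff_le_tail:
  fixes f h :: "'a::euclidean_space \<Rightarrow> real"
  assumes M_borel: "borel_distribution M" and "integrable M f" "integrable M h"
    and "\<And>x. \<bar>f x - h x\<bar> \<le> \<delta> + c * tail R x"
  shows "\<bar>(\<integral>x. f x \<partial>M) - (\<integral>x. h x \<partial>M)\<bar> \<le> \<delta> + c * (\<integral>x. tail R x \<partial>M)"
proof -
  interpret borel_distribution M by fact
  note integrable_tail[OF M_borel, simp]
  have "\<bar>(\<integral>x. f x \<partial>M) - (\<integral>x. h x \<partial>M)\<bar> \<le> (\<integral>x. \<bar>f x - h x\<bar> \<partial>M)"
    using integral_abs_bound[of M "\<lambda>x. f x - h x"] assms(2,3) by simp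
  also have "\<dots> \<le> (\<integral>x. \<delta> + c * tail R x \<partial>M)"
    using assms(2-4) by (intro integral_mono) auto
  also have "\<dots> = \<delta> + c * (\<integral>x. tail R x \<partial>M)"
    by (simp add: prob_space)
  finally show ?thesis .
qed

theorem converges_in_law_if_charfun_tendsto:
  fixes M :: "nat \<Rightarrow> 'a::euclidean_space measure"
  assumes M_borel: "\<And>n. borel_distribution (M n)" and \<mu>_borel: "borel_distribution \<mu>"
    and conv: "\<And>t. (\<lambda>n. charfun (M n) t) \<longlonglongrightarrow> charfun \<mu> t"
  shows "converges_in_law M \<mu>"
  unfolding converges_in_law_def
proof (intro allI impI, elim conjE)
  fix f :: "'a \<Rightarrow> real" assume f_continuous: "continuous_on UNIV f" and "bounded (range f)"
  then obtain B where f_bounded: "\<And>x. \<bar>f x\<bar> \<le> B" by (auto simp: bounded_iff)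
  show "(\<lambda>n. \<integral>x. f x \<partial>M n) \<longlonglongrightarrow> (\<integral>x. f x \<partial>\<mu>)"
  proof (rule tendstoI)
    fix e :: real assume "e > 0"
    define \<delta> where "\<delta> = min 1 (e / 5)"
    have \<delta>_range: "0 < \<delta>" "\<delta> \<le> 1" "5 * \<delta> \<le> e" using \<open>e > 0\<close> by (auto simp: \<delta>_def)
    define w where "w \<nu> R = (2 * B + 1) * (\<integral>x. tail (real R) x \<partial>\<nu>)" for \<nu> :: "'a measure" and R
    have "w \<mu> \<longlonglongrightarrow> 0"
      unfolding w_def[abs_def] by (intro tendsto_mult_right_zero integral_tail_tendsto_0 \<mu>_borel)
    then have "\<forall>\<^sub>F R in sequentially. w \<mu> R < \<delta>" using \<delta>_range(1) by (rule order_tendstoD)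
    then obtain R where R_tail: "w \<mu> R < \<delta>" by (auto simp: eventually_sequentially)
    obtain h where h_trig: "trig_poly h"
      and h_close: "\<And>x. \<bar>f x - h x\<bar> \<le> \<delta> + (2 * B + 1) * tail (real R) x"
      using trig_poly_approximation[OF f_continuous f_bounded \<delta>_range(1,2)]
      by (metis of_nat_0_le_iff)
    have approx: "\<bar>(\<integral>x. f x \<partial>\<nu>) - (\<integral>x. h x \<partial>\<nu>)\<bar> \<le> \<delta> + w \<nu> R" if "borel_distribution \<nu>" for \<nu>
      unfolding w_def using that f_bounded
      by (intro abs_integral_diff_le_tail h_close integrable_trig_poly h_trig
        borel_distribution.integrable_bounded_continuous[OF _ f_continuous, of _ B]) simp_all
    have "(\<lambda>n. w (M n) R) \<longlonglongrightarrow> w \<mu> R"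
      unfolding w_def by (intro tendsto_mult tendsto_const integral_tail_tendsto M_borel \<mu>_borel
        conv)
    then have "\<forall>\<^sub>F n in sequentially. w (M n) R < \<delta>" using R_tail by (rule order_tendstoD)
    moreover have "\<forall>\<^sub>F n in sequentially. dist (\<integral>x. h x \<partial>M n) (\<integral>x. h x \<partial>\<mu>) < \<delta>"
      using trig_poly_integral_tendsto[OF M_borel \<mu>_borel conv h_trig] \<delta>_range(1) by (rule tendstoD)
    ultimately show "\<forall>\<^sub>F n in sequentially. dist (\<integral>x. f x \<partial>M n) (\<integral>x. f x \<partial>\<mu>) < e"
    proof eventually_elim
      case (elim n)
      then show ?case
        using approx[OF M_borel, of n] approx[OF \<mu>_borel] R_tail \<delta>_range
        unfolding dist_real_def by linarith
    qed
  qed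
qed

section \<open>Gaussian vectors\<close>

subsection \<open>Positive semidefinite matrices\<close>

lemma inner_matrix_vector_commute: "transpose S = S \<Longrightarrow> x \<bullet> (S *v y) = y \<bullet> (S *v x)"
  for S :: "real ^ 'd ^ 'd"
  by (metis dot_lmul_matrix inner_commute transpose_matrix_vector)

lemma inner_matrix_vector_eq_sum: "x \<bullet> (S *v y) = (\<Sum>i\<in>UNIV. \<Sum>j\<in>UNIV. x $ i * y $ j * S $ i $ j)"
  for S :: "real ^ 'd ^ 'd"
  by (simp add: inner_vec_def matrix_vector_mult_def sum_distrib_left ac_simps)

lemma inner_axis_matrix_vector: "axis i 1 \<bullet> (S *v axis j 1) = S $ i $ j"
  for S :: "real ^ 'd ^ 'd"
  by (simp add: inner_axis' matrix_vector_mul_component inner_axis)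

lemma inner_matrix_vector_add_scaleR:
  fixes S :: "real ^ 'd ^ 'd"
  assumes "transpose S = S"
  shows "(x + c *\<^sub>R y) \<bullet> (S *v (x + c *\<^sub>R y))
    = x \<bullet> (S *v x) + 2 * c * (x \<bullet> (S *v y)) + c\<^sup>2 * (y \<bullet> (S *v y))"
  using inner_matrix_vector_commute[OF assms, of x y]
  by (simp add: matrix_vector_right_distrib matrix_vector_mult_scaleR inner_add_left inner_add_right
    power2_eq_square algebra_simps)

lemma nonneg_quadratic_discriminant:
  fixes a b d :: real
  assumes nonneg: "\<And>c. 0 \<le> a + 2 * c * b + c\<^sup>2 * d" and "0 \<le> d"
  shows "b\<^sup>2 \<le> a * d"
proof (cases "d = 0")
  case True
  have "b = 0"
  proof (rule ccontr)
    assume "b \<noteq> 0"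
    then have "2 * (- (a + 1) / (2 * b)) * b = - (a + 1)" by simp
    then show False using nonneg[of "- (a + 1) / (2 * b)"] True by simp
  qed
  then show ?thesis using True by simp
next
  case False
  then show ?thesis
    using nonneg[of "- b / d"] \<open>0 \<le> d\<close> by (simp add: field_simps power2_eq_square)
qed

lemma pos_semidefinite_Cauchy_Schwarz:
  assumes "pos_semidefinite S"
  shows "(x \<bullet> (S *v y))\<^sup>2 \<le> (x \<bullet> (S *v x)) * (y \<bullet> (S *v y))"
  using assms unfolding pos_semidefinite_def
  by (intro nonneg_quadratic_discriminant) (auto simp flip: inner_matrix_vector_add_scaleR)

definition rank_one :: "real ^ 'd \<Rightarrow> real ^ 'd ^ 'd" where
  "rank_one v = (\<chi> i j. v $ i * v $ j)"

lemma inner_rank_one: "x \<bullet> (rank_one v *v y) = (v \<bullet> x) * (v \<bullet> y)"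
  unfolding inner_matrix_vector_eq_sum
  by (simp add: rank_one_def inner_vec_def sum_product ac_simps)

lemma pos_semidefinite_pivot:
  fixes S :: "real ^ 'd ^ 'd"
  assumes psd: "pos_semidefinite S" and pivot: "S $ a $ a \<noteq> 0"
  defines "v \<equiv> S *v axis a 1 /\<^sub>R sqrt (S $ a $ a)"
  shows "pos_semidefinite (S - rank_one v)" "(S - rank_one v) $ a $ a = 0"
proof -
  let ?\<alpha> = "S $ a $ a"
  have sym: "transpose S = S" and nonneg: "0 \<le> x \<bullet> (S *v x)" for x
    using psd by (auto simp: pos_semidefinite_def)
  have "0 \<le> ?\<alpha>" using nonneg[of "axis a 1"] by (simp only: inner_axis_matrix_vector)
  with pivot have \<alpha>_pos: "0 < ?\<alpha>" by simp
  have v_inner: "v \<bullet> x = (x \<bullet> (S *v axis a 1)) / sqrt ?\<alpha>" for x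
    by (simp add: v_def inner_commute divide_inverse)
  have "(v \<bullet> x)\<^sup>2 \<le> x \<bullet> (S *v x)" for x
    using pos_semidefinite_Cauchy_Schwarz[OF psd, of x "axis a 1"] \<alpha>_pos
    by (simp add: v_inner inner_axis_matrix_vector power_divide divide_le_eq)
  then have "0 \<le> x \<bullet> ((S - rank_one v) *v x)" for x
    by (simp add: matrix_vector_mult_diff_rdistrib inner_diff_right inner_rank_one power2_eq_square)
  moreover have "transpose (S - rank_one v) = S - rank_one v"
    using sym by (simp add: transpose_def rank_one_def vec_eq_iff mult.commute)
  ultimately show "pos_semidefinite (S - rank_one v)"
    by (simp add: pos_semidefinite_def)
  have "v $ a = sqrt ?\<alpha>"
    using v_inner[of "axis a 1"] \<alpha>_pos
    by (simp add: inner_axis_matrix_vector inner_axis real_div_sqrt)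
  then show "(S - rank_one v) $ a $ a = 0"
    using \<alpha>_pos by (simp add: rank_one_def)
qed

lemma pos_semidefinite_sum_of_squares:
  fixes S :: "real ^ 'd ^ 'd"
  assumes "pos_semidefinite S"
  shows "\<exists>(m :: nat) w. \<forall>x. x \<bullet> (S *v x) = (\<Sum>k<m. (w k \<bullet> x)\<^sup>2)"
  using assms
proof (induction "card {i. S $ i $ i \<noteq> 0}" arbitrary: S rule: less_induct)
  case less
  have diag_nonneg: "0 \<le> T $ i $ i" if "pos_semidefinite T" for T :: "real ^ 'd ^ 'd" and i
    using that unfolding pos_semidefinite_def by (metis inner_axis_matrix_vector)
  show ?case
  proof (cases "\<exists>a. S $ a $ a \<noteq> 0")
    case True
    then obtain a where pivot: "S $ a $ a \<noteq> 0" by blast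
    define v where "v = S *v axis a 1 /\<^sub>R sqrt (S $ a $ a)"
    define T where "T = S - rank_one v"
    have T_reduced: "pos_semidefinite T" "T $ a $ a = 0"
      using pos_semidefinite_pivot[OF less.prems pivot] by (simp_all add: T_def v_def)
    have "T $ i $ i \<le> S $ i $ i" for i by (simp add: T_def rank_one_def)
    then have "{i. T $ i $ i \<noteq> 0} \<subseteq> {i. S $ i $ i \<noteq> 0}"
      using diag_nonneg[OF T_reduced(1)] by (metis (mono_tags, lifting) Collect_mono order_antisym)
    with T_reduced(2) pivot have "card {i. T $ i $ i \<noteq> 0} < card {i. S $ i $ i \<noteq> 0}"
      by (intro psubset_card_mono) auto
    from less.hyps[OF this T_reduced(1)]
    obtain m w where T_squares: "\<And>x. x \<bullet> (T *v x) = (\<Sum>k<(m::nat). (w k \<bullet> x)\<^sup>2)" by blast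
    have "x \<bullet> (S *v x) = (\<Sum>k<Suc m. ((w(m := v)) k \<bullet> x)\<^sup>2)" for x
    proof -
      have "x \<bullet> (S *v x) = x \<bullet> (T *v x) + (v \<bullet> x)\<^sup>2"
        by (simp add: T_def matrix_vector_mult_diff_rdistrib inner_diff_right inner_rank_one
          power2_eq_square)
      then show ?thesis by (simp add: T_squares)
    qed
    then show ?thesis by blast
  next
    case False
    have "S $ i $ j = 0" for i j
      using pos_semidefinite_Cauchy_Schwarz[OF less.prems, of "axis i 1" "axis j 1"] False
      by (simp add: inner_axis_matrix_vector)
    then have "x \<bullet> (S *v x) = 0" for x
      by (simp add: inner_matrix_vector_eq_sum)
    then show ?thesis by (intro exI[of _ 0]) simp
  qed
qed

subsection \<open>Existence\<close>

lemma cis_sum: "finite I \<Longrightarrow> cis (\<Sum>k\<in>I. f k) = (\<Prod>k\<in>I. cis (f k))"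
  by (induction I rule: finite_induct) (auto simp flip: cis_mult)

lemma charfun_sum_std_normal:
  fixes w :: "nat \<Rightarrow> 'a::euclidean_space" and m :: nat
  defines "\<mu> \<equiv> distr (Pi\<^sub>M {..<m} (\<lambda>_. std_normal_distribution)) borel (\<lambda>\<xi>. \<Sum>k<m. \<xi> k *\<^sub>R w k)"
  shows "borel_distribution \<mu>" "charfun \<mu> t = exp (- ((\<Sum>k<m. (w k \<bullet> t)\<^sup>2) / 2))"
proof -
  let ?N = "Pi\<^sub>M {..<m} (\<lambda>_. std_normal_distribution)" and ?X = "\<lambda>\<xi>. \<Sum>k<m. \<xi> k *\<^sub>R w k"
  interpret std: real_distribution std_normal_distribution by (rule real_dist_normal_dist)
  interpret product_sigma_finite "\<lambda>_::nat. std_normal_distribution" by unfold_locales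
  interpret N: prob_space ?N by (intro prob_space_PiM) unfold_locales
  have [measurable]: "?X \<in> borel_measurable ?N"
    by measurable
  show "borel_distribution \<mu>"
    unfolding \<mu>_def borel_distribution_def borel_distribution_axioms_def
    by (auto intro: N.prob_space_distr)
  have "(\<lambda>x :: 'a. cis (t \<bullet> x)) \<in> borel_measurable borel"
    by (intro borel_measurable_continuous_onI continuous_intros)
  then have "charfun \<mu> t = (\<integral>\<xi>. cis (t \<bullet> ?X \<xi>) \<partial>?N)"
    unfolding charfun_def \<mu>_def by (intro integral_distr) measurable
  also have "\<dots> = (\<integral>\<xi>. (\<Prod>k<m. cis ((w k \<bullet> t) * \<xi> k)) \<partial>?N)"
    by (simp add: inner_sum_right inner_commute[of t] mult.commute cis_sum)
  also have "\<dots> = (\<Prod>k<m. \<integral>y. cis ((w k \<bullet> t) * y) \<partial>std_normal_distribution)"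
  proof (rule product_integral_prod)
    show "integrable std_normal_distribution (\<lambda>y. cis ((w k \<bullet> t) * y))" for k
      using std.integrable_iexp[of "\<lambda>y. (w k \<bullet> t) * y"] by (simp add: cis_conv_exp)
  qed simp
  also have "\<dots> = (\<Prod>k<m. char std_normal_distribution (w k \<bullet> t))"
    by (simp add: char_def cis_conv_exp)
  also have "\<dots> = exp (- ((\<Sum>k<m. (w k \<bullet> t)\<^sup>2) / 2))"
    unfolding char_std_normal_distribution
    by (simp add: sum_divide_distrib flip: of_real_prod exp_sum sum_negf)
  finally show "charfun \<mu> t = exp (- ((\<Sum>k<m. (w k \<bullet> t)\<^sup>2) / 2))" .
qed

lemma gaussian_charfun_exists:
  fixes S :: "real ^ 'd ^ 'd"
  assumes "pos_semidefinite S"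
  obtains \<mu> where "borel_distribution \<mu>" "\<And>t. charfun \<mu> t = exp (- ((t \<bullet> (S *v t)) / 2))"
proof -
  from pos_semidefinite_sum_of_squares[OF assms]
  obtain m :: nat and w where squares: "\<And>x. x \<bullet> (S *v x) = (\<Sum>k<m. (w k \<bullet> x)\<^sup>2)" by blast
  show thesis
    by (rule that, rule charfun_sum_std_normal(1), unfold squares, rule charfun_sum_std_normal(2))
qed

subsection \<open>Identification by the characteristic function\<close>

lemma normal_law_eq_distr:
  assumes "v \<ge> 0"
  shows "normal_law m v = distr std_normal_distribution borel (\<lambda>x. m + sqrt v * x)"
proof -
  interpret std: real_distribution std_normal_distribution by (rule real_dist_normal_dist)
  show ?thesis
  proof (cases "v = 0")
    case True
    have "distr std_normal_distribution borel (\<lambda>x. m) = return borel m"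
      by (rule std.distr_const) simp
    then show ?thesis using True by (simp add: normal_law_def)
  next
    case False
    have "distributed std_normal_distribution lborel (\<lambda>x. x) (normal_density 0 1)"
      by (auto simp: distributed_def distr_id2 intro!: distr_id2)
    from std.normal_density_affine[OF this, of "sqrt v" m] False assms
    have "distr std_normal_distribution lborel (\<lambda>x. m + sqrt v * x)
        = density lborel (normal_density m (sqrt v))"
      by (simp add: distributed_def)
    moreover have "distr std_normal_distribution lborel (\<lambda>x. m + sqrt v * x)
        = distr std_normal_distribution borel (\<lambda>x. m + sqrt v * x)"
      by (rule distr_cong) auto
    ultimately show ?thesis using False by (simp add: normal_law_def)
  qed
qed

lemma real_distribution_normal_law: "v \<ge> 0 \<Longrightarrow> real_distribution (normal_law m v)"
  using prob_space.real_distribution_distr[OF real_distribution.axioms(1)[OF real_dist_normal_dist],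
    of "\<lambda>x. m + sqrt v * x"]
  by (simp add: normal_law_eq_distr)

lemma char_centered_normal_law:
  assumes "v \<ge> 0"
  shows "char (normal_law 0 v) s = exp (- (s\<^sup>2 * v / 2))"
proof -
  have "char (normal_law 0 v) s = char std_normal_distribution (s * sqrt v)"
    unfolding normal_law_eq_distr[OF assms] char_def
    by (subst integral_distr) (auto simp: mult.assoc)
  then show ?thesis using assms by (simp add: char_std_normal_distribution power_mult_distrib)
qed

lemma centered_normal_law_moments:
  assumes "v \<ge> 0"
  shows "(\<integral>x. x \<partial>normal_law 0 v) = 0" "integrable (normal_law 0 v) (\<lambda>x. x\<^sup>2)"
    "(\<integral>x. x\<^sup>2 \<partial>normal_law 0 v) = v"
proof -
  have mean: "(\<integral>x. x \<partial>std_normal_distribution) = 0"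
    using integral_std_normal_distribution_moment_odd[of 1] by simp
  have variance: "(\<integral>x. x\<^sup>2 \<partial>std_normal_distribution) = 1"
    using std_normal_distribution_even_moments(1)[of 1] by simp
  show "(\<integral>x. x \<partial>normal_law 0 v) = 0" "(\<integral>x. x\<^sup>2 \<partial>normal_law 0 v) = v"
    unfolding normal_law_eq_distr[OF assms]
    by (subst integral_distr; simp add: mean variance power_mult_distrib assms)+
  show "integrable (normal_law 0 v) (\<lambda>x. x\<^sup>2)"
    unfolding normal_law_eq_distr[OF assms]
    by (subst integrable_distr_eq) (auto simp: power_mult_distrib intro!: integrable_mult_right
      integrable_std_normal_distribution_moment)
qed

lemma distr_inner_eq_normal_law:
  fixes \<mu> :: "'a::euclidean_space measure"
  assumes \<mu>_borel: "borel_distribution \<mu>" and v_nonneg: "v \<ge> 0"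
    and charfun: "\<And>s. charfun \<mu> (s *\<^sub>R t) = exp (- (s\<^sup>2 * v / 2))"
  shows "distr \<mu> borel (\<lambda>x. t \<bullet> x) = normal_law 0 v"
proof (rule Levy_uniqueness)
  show "char (distr \<mu> borel (\<lambda>x. t \<bullet> x)) = char (normal_law 0 v)"
    by (rule ext)
      (simp add: char_distr_inner[OF \<mu>_borel] charfun char_centered_normal_law[OF v_nonneg])
qed (simp_all add: real_distribution_distr_inner \<mu>_borel real_distribution_normal_law v_nonneg)

lemma integral_mult_component_if_quadratic:
  fixes \<mu> :: "(real ^ 'd) measure"
  assumes sym: "transpose S = S"
    and integrable: "\<And>t. integrable \<mu> (\<lambda>x. (t \<bullet> x)\<^sup>2)"
    and quadratic: "\<And>t. (\<integral>x. (t \<bullet> x)\<^sup>2 \<partial>\<mu>) = t \<bullet> (S *v t)"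
  shows "(\<integral>x. x $ i * x $ j \<partial>\<mu>) = S $ i $ j"
proof -
  let ?e = "\<lambda>c. axis i 1 + c *\<^sub>R axis j 1 :: real ^ 'd"
  have "(\<integral>x. x $ i * x $ j \<partial>\<mu>) = (\<integral>x. ((?e 1 \<bullet> x)\<^sup>2 - (?e (- 1) \<bullet> x)\<^sup>2) / 4 \<partial>\<mu>)"
    by (intro Bochner_Integration.integral_cong refl)
      (simp add: inner_add_left inner_diff_left inner_axis' power2_eq_square field_simps)
  also have "\<dots> = (?e 1 \<bullet> (S *v ?e 1) - ?e (- 1) \<bullet> (S *v ?e (- 1))) / 4"
    using integrable
    by (simp only: Bochner_Integration.integral_diff quadratic integral_divide_zero)
  also have "\<dots> = S $ i $ j"
    unfolding inner_matrix_vector_add_scaleR[OF sym] inner_axis_matrix_vector by simp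
  finally show ?thesis .
qed

theorem centered_gaussian_law_if_charfun:
  fixes S :: "real ^ 'd ^ 'd"
  assumes psd: "pos_semidefinite S" and \<mu>_borel: "borel_distribution \<mu>"
    and charfun: "\<And>t. charfun \<mu> t = exp (- ((t \<bullet> (S *v t)) / 2))"
  shows "centered_gaussian_law S \<mu>"
proof -
  interpret borel_distribution \<mu> by fact
  have sym: "transpose S = S" and nonneg: "\<And>t. 0 \<le> t \<bullet> (S *v t)"
    using psd by (auto simp: pos_semidefinite_def)
  have law: "distr \<mu> borel (\<lambda>x. t \<bullet> x) = normal_law 0 (t \<bullet> (S *v t))" for t
    by (rule distr_inner_eq_normal_law[OF \<mu>_borel nonneg])
      (simp add: charfun power2_eq_square matrix_vector_mult_scaleR mult.assoc)
  note moments = centered_normal_law_moments[OF nonneg, unfolded law[symmetric]]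
  have "(\<integral>x. t \<bullet> x \<partial>\<mu>) = 0" for t
    using moments(1)[of t] by (subst (asm) integral_distr) auto
  from this[of "axis _ 1"] have "(\<integral>x. x $ i \<partial>\<mu>) = 0" for i by (simp add: inner_axis')
  moreover have "(\<integral>x. x $ i * x $ j \<partial>\<mu>) = S $ i $ j" for i j
  proof (rule integral_mult_component_if_quadratic[OF sym])
    show "integrable \<mu> (\<lambda>x. (t \<bullet> x)\<^sup>2)" for t
      using moments(2)[of t] by (subst (asm) integrable_distr_eq) auto
    show "(\<integral>x. (t \<bullet> x)\<^sup>2 \<partial>\<mu>) = t \<bullet> (S *v t)" for t
      using moments(3)[of t] by (subst (asm) integral_distr) auto
  qed
  ultimately show ?thesis
    unfolding centered_gaussian_law_def gaussian_vector_law_def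
    using prob_space_axioms sets_eq_borel law nonneg by blast
qed

section \<open>The central limit theorem\<close>

lemma integral_pmf_of_set_lessThan:
  fixes f :: "nat \<Rightarrow> 'a::{banach, second_countable_topology}"
  assumes "N > 0"
  shows "(\<integral>n. f n \<partial>measure_pmf (pmf_of_set {..<N})) = avg N f"
proof -
  have nonempty: "{..<N} \<noteq> {}" using assms by auto
  then have "(\<integral>n. f n \<partial>measure_pmf (pmf_of_set {..<N})) = (\<Sum>n<N. pmf (pmf_of_set {..<N}) n *\<^sub>R f n)"
    by (intro integral_measure_pmf) auto
  also have "\<dots> = (\<Sum>n<N. (1 / real N) *\<^sub>R f n)"
    using nonempty by (intro sum.cong refl) simp
  finally show ?thesis by (simp add: avg_def scaleR_sum_right[symmetric] divide_inverse)
qed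

context digit_base
begin

definition digit_cov_matrix :: "('d::finite \<Rightarrow> nat) \<Rightarrow> real ^ 'd ^ 'd" where
  "digit_cov_matrix A = (\<chi> i j. digit_cov (A i) (A j))"

definition normalized_digit_sums :: "('d::finite \<Rightarrow> nat) \<Rightarrow> nat \<Rightarrow> nat \<Rightarrow> real ^ 'd" where
  "normalized_digit_sums A N n =
    (\<chi> i. (real (digit_sum q (A i * n)) - (real q - 1) / 2 * log q N) / sqrt (log q N))"

definition digit_sums_law :: "('d::finite \<Rightarrow> nat) \<Rightarrow> nat \<Rightarrow> (real ^ 'd) measure" where
  "digit_sums_law A N = distr (measure_pmf (pmf_of_set {..<N})) borel (normalized_digit_sums A N)"

lemma inner_digit_cov_matrix: "t \<bullet> (digit_cov_matrix A *v t) = digit_form A (($) t)"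
  by (simp add: inner_matrix_vector_eq_sum digit_cov_matrix_def digit_form_def)

lemma pos_semidefinite_digit_cov_matrix:
  "(\<And>i. A i > 0) \<Longrightarrow> pos_semidefinite (digit_cov_matrix A)"
  unfolding pos_semidefinite_def inner_digit_cov_matrix digit_form_eq_saw_form
  by (simp add: saw_form_nonneg digit_cov_matrix_def digit_cov_def transpose_def vec_eq_iff
    saw_cov_commute)

lemma digit_cov_matrix_prime:
  assumes "prime q" "\<And>i. \<not> q dvd A i"
  shows "digit_cov_matrix A
    = (\<chi> i j. ((real q)\<^sup>2 - 1) / 12 * ((real (gcd (A i) (A j)))\<^sup>2 / (real (A i) * real (A j))))"
  by (simp only: digit_cov_matrix_def digit_cov_prime[OF assms(1) assms(2) assms(2)])

lemma borel_distribution_digit_sums_law: "borel_distribution (digit_sums_law A N)"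
  unfolding borel_distribution_def borel_distribution_axioms_def digit_sums_law_def
  by (simp add: measure_pmf.prob_space_distr)

lemma charfun_digit_sums_law:
  assumes "N > 0"
  shows "charfun (digit_sums_law A N) t = avg N (\<lambda>n. cis (\<Sum>i\<in>UNIV. t $ i *
    ((real (digit_sum q (A i * n)) - (real q - 1) / 2 * log q N) / sqrt (log q N))))"
proof -
  have "charfun (digit_sums_law A N) t
      = (\<integral>n. cis (t \<bullet> normalized_digit_sums A N n) \<partial>measure_pmf (pmf_of_set {..<N}))"
    unfolding charfun_def digit_sums_law_def
    by (rule integral_distr) (auto intro!: borel_measurable_continuous_onI continuous_intros)
  then show ?thesis
    by (simp add: integral_pmf_of_set_lessThan[OF assms] inner_vec_def normalized_digit_sums_def)
qed

lemma charfun_digit_sums_law_tendsto: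
  assumes "\<And>i. A i > 0"
  shows "(\<lambda>N. charfun (digit_sums_law A N) t)
    \<longlonglongrightarrow> of_real (exp (- ((t \<bullet> (digit_cov_matrix A *v t)) / 2)))"
  unfolding inner_digit_cov_matrix
proof (rule Lim_transform_eventually[OF avg_cis_digit_sums_tendsto[OF assms]])
  show "\<forall>\<^sub>F N in sequentially. avg N (\<lambda>n. cis (\<Sum>i\<in>UNIV. t $ i *
      ((real (digit_sum q (A i * n)) - (real q - 1) / 2 * log q N) / sqrt (log q N))))
    = charfun (digit_sums_law A N) t"
    using eventually_gt_at_top[of 0] by eventually_elim (simp add: charfun_digit_sums_law)
qed

end

theorem theorem1:
  fixes q :: nat and A :: "'d::finite \<Rightarrow> nat"
  assumes "q \<ge> 2" and "\<And>i. A i > 0"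
  shows "\<exists>S :: real ^ 'd ^ 'd.
    pos_semidefinite S \<and>
    (\<exists>\<mu>. centered_gaussian_law S \<mu> \<and>
      converges_in_law
        (\<lambda>N. distr (measure_pmf (pmf_of_set {..<N})) borel
          (\<lambda>n. \<chi> i. (real (digit_sum q (A i * n)) - (real q - 1) / 2 * log (real q) (real N))
                     / sqrt (log (real q) (real N))))
        \<mu>) \<and>
    (prime q \<and> (\<forall>i. \<not> q dvd A i) \<longrightarrow>
      S = (\<chi> i j. ((real q)\<^sup>2 - 1) / 12 *
                   ((real (gcd (A i) (A j)))\<^sup>2 / (real (A i) * real (A j)))))"
proof -
  interpret digit_base q by unfold_locales (rule assms(1))
  have psd: "pos_semidefinite (digit_cov_matrix A)"
    by (rule pos_semidefinite_digit_cov_matrix) (rule assms(2))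
  obtain \<mu> where \<mu>_borel: "borel_distribution \<mu>"
    and charfun: "\<And>t. charfun \<mu> t = exp (- ((t \<bullet> (digit_cov_matrix A *v t)) / 2))"
    using gaussian_charfun_exists[OF psd] by blast
  have "converges_in_law (digit_sums_law A) \<mu>"
    by (rule converges_in_law_if_charfun_tendsto[OF borel_distribution_digit_sums_law \<mu>_borel])
      (simp only: charfun charfun_digit_sums_law_tendsto[OF assms(2)])
  note law = this[unfolded digit_sums_law_def[abs_def] normalized_digit_sums_def[abs_def]]
  have "centered_gaussian_law (digit_cov_matrix A) \<mu>"
    by (rule centered_gaussian_law_if_charfun[OF psd \<mu>_borel charfun])
  with psd law show ?thesis
    by (intro exI[of _ "digit_cov_matrix A"] exI[of _ \<mu>] conjI impI digit_cov_matrix_prime)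
      simp_all
qed

end
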